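(* Let $t\ge1$ be an integer and $g=2t-1$. Let $\lambda\in\mathcal{DD}_{g}^{'1}$, let $\mathbf{v}\in\mathbb{Z}^t$ be its $V_{g,t}$-coding, and set $r_i=v_i-g/2+1$ for $1\le i\le t$. Then $$|\lambda| = \frac{1}{g}\sum_{i=1}^{t} r_i^2-\frac{(g+2)(\lfloor g/2\rfloor +1)}{12}.$$ Moreover, setting $\alpha_i(\lambda)=\#\{s\in\lambda\mid h_s=g-i,\ \varepsilon_s=1\}$, for any field $F$ and any function $\tau:\mathbb{Z}\to F^{\times}$, $$\prod_{s\in\lambda}\frac{\tau(h_s-\varepsilon_s g)}{\tau(h_s)}=\prod_{i=1}^{g-1}\left(\frac{\tau(-i)}{\tau(i)}\right)^{\alpha_i(\lambda)}\prod_{1\le i<j\le t} \frac{\tau(r_i-r_j)}{\tau(j-i)}\, \frac{\tau(r_i+r_j)}{\tau(g+2-i-j)}.$$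
   Context: For a partition $\lambda$, $h_s$ is the hook length of a box $s$, $d_\lambda=\max\{s:\lambda_s\ge s\}$, and $\varepsilon_s=-1$ if $s$ is strictly below the main diagonal of the Ferrers diagram (English convention), $\varepsilon_s=1$ otherwise. $\mathcal{DD}$ is the set of partitions with $\lambda_i=\lambda'_i+1$ for $1\le i\le d_\lambda$ ($\lambda'$ the conjugate; the empty partition included), and $\mathcal{DD}'=\{\lambda'\mid\lambda\in\mathcal{DD}\}$. Word of a partition: $\psi(\lambda)=(c_k)_{k\in\mathbb{Z}}\in\{0,1\}^{\mathbb{Z}}$ encodes the border of the Ferrers diagram read from South-West to North-East ($0$ vertical step, $1$ horizontal step), indexed so that $\#\{k\le -1: c_k=1\}=\#\{k\ge 0: c_k=0\}$; equivalently $c_k=0$ iff $k=\lambda_i-i$ for some $i\ge1$ (with $\lambda_i=0$ beyond the length). The $g$-quotient of $\lambda$ is $(\nu^{(0)},\dots,\nu^{(g-1)})$, where $\nu^{(k)}$ is the partition whose word is, up to a shift of indices, the subword $(c_{gi+k})_{i\in\mathbb{Z}}$. $\mathcal{DD}_{2t-1}^{'1}$ is the set of $\lambda\in\mathcal{DD}'$ whose $(2t-1)$-quotient satisfies $\nu^{(k)}=\emptyset$ for all $k\ne 2t-2$ and $\nu^{(2t-2)}$ is, for some integer $m_1\ge 1$, the rectangular partition with $m_1$ parts all equal to $m_1-1$ (empty if $m_1=1$). $V_{g,t}$-coding: for $i\in\{0,\dots,g-1\}$ let $\beta_i=\max\{(k+1)g+i\mid k\in\mathbb{Z},\ c_{kg+i}=0\}$;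 the $V_{g,t}$-coding is $\mathbf{v}=(v_1>\dots>v_t)$, the $t$ largest of the distinct integers $\beta_0,\dots,\beta_{g-1}$ in decreasing order. (Here the $r_i$ are half-integers, and $r_i\pm r_j$ are integers.) *)

theory Defs
  imports Complex_Main
begin

definition is_partition :: "nat list \<Rightarrow> bool" where
  "is_partition l \<longleftrightarrow> sorted_wrt (\<ge>) l \<and> (\<forall>x\<in>set l. x > 0)"

text \<open>Parts are indexed from 1 and vanish beyond the length. The junk value at index 0 is 0.\<close>

definition part :: "nat list \<Rightarrow> nat \<Rightarrow> nat" where
  "part l i = (if 1 \<le> i \<and> i \<le> length l then l ! (i - 1) else 0)"

definition conjugate :: "nat list \<Rightarrow> nat list" where
  "conjugate l = map (\<lambda>j. card {i. 1 \<le> i \<and> i \<le> length l \<and> part l i \<ge> j}) [1..<Suc (part l 1)]"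

text \<open>The box \<open>(i, j)\<close> lies in row \<open>i\<close> (counted from the top) and column \<open>j\<close>.\<close>

definition boxes :: "nat list \<Rightarrow> (nat \<times> nat) set" where
  "boxes l = {(i, j). 1 \<le> i \<and> i \<le> length l \<and> 1 \<le> j \<and> j \<le> part l i}"

definition hook_length :: "nat list \<Rightarrow> nat \<times> nat \<Rightarrow> int" where
  "hook_length l s = (case s of (i, j) \<Rightarrow>
     (int (part l i) - int j) + (int (part (conjugate l) j) - int i) + 1)"

definition diag_sign :: "nat \<times> nat \<Rightarrow> int" where
  "diag_sign s = (case s of (i, j) \<Rightarrow> if i > j then - 1 else 1)"

text \<open>Since \<open>part l 0 = 0\<close>, the set below always contains 0, so that the empty partition
  gets the value 0; it is finite because the parts vanish beyond the length.\<close>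

definition durfee :: "nat list \<Rightarrow> nat" where
  "durfee l = Max {s. part l s \<ge> s}"

definition DD :: "nat list set" where
  "DD = {l. is_partition l \<and> (\<forall>i\<in>{1..durfee l}. part l i = part (conjugate l) i + 1)}"

definition DD' :: "nat list set" where
  "DD' = conjugate ` DD"

text \<open>The border of the diagram read from South-West to North-East: the letter 0 (vertical step)
  belonging to row \<open>i\<close> has index \<open>part l i - i\<close>, where rows of length 0 are allowed; all other
  letters are 1. The lemma \<open>word_balanced\<close> below shows that this indexing is the balanced one.\<close>

definition word :: "nat list \<Rightarrow> int \<Rightarrow> nat" where
  "word l k = (if \<exists>i\<ge>1. k = int (part l i) - int i then 0 else 1)"

text \<open>The tuple \<open>(\<nu> 0, \<dots>, \<nu> (g - 1))\<close> is the \<open>g\<close>-quotient of \<open>l\<close>; the integer \<open>d\<close> is the shift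
  of indices. Values of \<open>\<nu>\<close> at indices \<open>\<ge> g\<close> are irrelevant.\<close>

definition is_quotient :: "nat \<Rightarrow> nat list \<Rightarrow> (nat \<Rightarrow> nat list) \<Rightarrow> bool" where
  "is_quotient g l \<nu> \<longleftrightarrow>
     (\<forall>k<g. is_partition (\<nu> k) \<and>
        (\<exists>d::int. \<forall>i::int. word (\<nu> k) i = word l (int g * (i + d) + int k)))"

definition rectangle :: "nat \<Rightarrow> nat \<Rightarrow> nat list" where
  "rectangle m n = (if n = 0 then [] else replicate m n)"

definition DD'1 :: "nat \<Rightarrow> nat list set" where
  "DD'1 t = {l \<in> DD'. \<exists>\<nu>. is_quotient (2 * t - 1) l \<nu> \<and>
      (\<forall>k < 2 * t - 1. k \<noteq> 2 * t - 2 \<longrightarrow> \<nu> k = []) \<and>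
      (\<exists>m\<ge>1. \<nu> (2 * t - 2) = rectangle m (m - 1))}"

text \<open>The set whose maximum is taken is unbounded below, hence not \<^const>\<open>Max\<close>.\<close>

definition coding_beta :: "nat \<Rightarrow> nat list \<Rightarrow> nat \<Rightarrow> int" where
  "coding_beta g l i =
     (GREATEST x. \<exists>k::int. x = (k + 1) * int g + int i \<and> word l (k * int g + int i) = 0)"

definition V_coding :: "nat \<Rightarrow> nat \<Rightarrow> nat list \<Rightarrow> int list" where
  "V_coding g t l = take t (rev (sorted_list_of_set (coding_beta g l ` {0..<g})))"

definition hook_count :: "nat \<Rightarrow> nat list \<Rightarrow> nat \<Rightarrow> nat" where
  "hook_count g l i = card {s \<in> boxes l. hook_length l s = int g - int i \<and> diag_sign s = 1}"

text \<open>Sums and differences of the numbers \<open>r\<^sub>i = v\<^sub>i - g / 2 + 1\<close> are integers, so taking their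
  floor only changes the type.\<close>

lemma shifted_coding_diff_int:
  fixes a b :: int and g :: nat
  assumes "x = real_of_int a - real g / 2 + 1" and "y = real_of_int b - real g / 2 + 1"
  shows "real_of_int \<lfloor>x - y\<rfloor> = x - y"
proof -
  have "x - y = real_of_int (a - b)" using assms by simp
  then show ?thesis by (metis floor_of_int)
qed

lemma shifted_coding_add_int:
  fixes a b :: int and g :: nat
  assumes "x = real_of_int a - real g / 2 + 1" and "y = real_of_int b - real g / 2 + 1"
  shows "real_of_int \<lfloor>x + y\<rfloor> = x + y"
proof -
  have "x + y = real_of_int (a + b - int g + 2)" using assms by simp
  then show ?thesis by (metis floor_of_int)
qed

lemma part_antimono:
  assumes "is_partition l" "1 \<le> i" "i \<le> j"
  shows "part l j \<le> part l i"
proof (cases "i < j \<and> j \<le> length l")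
  case True
  then have "l ! (i - 1) \<ge> l ! (j - 1)"
    using assms sorted_wrt_nth_less[of "\<lambda>x y. y \<le> x" l "i - 1" "j - 1"]
    unfolding is_partition_def by linarith
  then show ?thesis using True assms by (simp add: part_def)
next
  case False
  then have "i = j \<or> part l j = 0" using assms by (auto simp: part_def)
  then show ?thesis by auto
qed

lemma word_balanced:
  assumes "is_partition l"
  shows "card {k. k \<le> - 1 \<and> word l k = 1} = card {k. k \<ge> 0 \<and> word l k = 0}"
    and "finite {k. k \<le> - 1 \<and> word l k = 1}" and "finite {k. k \<ge> 0 \<and> word l k = 0}"
proof -
  define n where "n = length l"
  define f where "f = (\<lambda>i. int (part l i) - int i)"
  have f_less: "f j < f i" if "1 \<le> i" "i < j" for i j
    using part_antimono[OF assms that(1), of j] that by (simp add: f_def)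
  have inj: "inj_on f {1..n}"
    by (rule inj_onI) (metis atLeastAtMost_iff f_less less_irrefl nat_neq_iff)
  define A where "A = f ` {1..n}"
  have cardA: "card A = n" and finA: "finite A"
    using inj by (auto simp: A_def card_image)
  have f_out: "f i = - int i" if "i > n" for i
    using that by (simp add: f_def part_def n_def)
  have f_in: "f i \<ge> - int n" if "i \<in> {1..n}" for i
    using that by (simp add: f_def)
  have w0: "word l k = 0 \<longleftrightarrow> k \<in> A \<or> k < - int n" for k
  proof
    assume "word l k = 0"
    then obtain i where i: "i \<ge> 1" "k = f i" by (auto simp: word_def f_def split: if_splits)
    show "k \<in> A \<or> k < - int n"
      using i f_out[of i] by (cases "i \<le> n") (auto simp: A_def)
  next
    assume "k \<in> A \<or> k < - int n"
    then have "\<exists>i\<ge>1. k = f i"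
    proof
      assume "k < - int n"
      then show ?thesis using f_out[of "nat (- k)"] by (intro exI[of _ "nat (- k)"]) auto
    qed (auto simp: A_def)
    then show "word l k = 0" by (auto simp: word_def f_def)
  qed
  have w1: "word l k = 1 \<longleftrightarrow> \<not> (k \<in> A \<or> k < - int n)" for k
    unfolding w0[symmetric] by (simp add: word_def)
  have pos: "{k. k \<ge> 0 \<and> word l k = 0} = A - {- int n..-1}"
    using f_in by (auto simp: w0 A_def)
  have neg: "{k. k \<le> - 1 \<and> word l k = 1} = {- int n..-1} - A"
    unfolding w1 by auto
  show "finite {k. k \<le> - 1 \<and> word l k = 1}" "finite {k. k \<ge> 0 \<and> word l k = 0}"
    unfolding pos neg using finA by auto
  have "card ({- int n..-1} - A) = n - card ({- int n..-1} \<inter> A)"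
    by (simp add: card_Diff_subset_Int)
  moreover have "card (A - {- int n..-1}) = n - card ({- int n..-1} \<inter> A)"
    using finA cardA by (simp add: card_Diff_subset_Int Int_commute)
  ultimately show "card {k. k \<le> - 1 \<and> word l k = 1} = card {k. k \<ge> 0 \<and> word l k = 0}"
    unfolding pos neg by simp
qed

end

theory Submission
  imports Defs
begin

text \<open>
  Shift the indices of the word by one and let \<open>S\<close> be the resulting set of vertical steps. Membership
  in \<open>DD'\<close> means that \<open>0 \<in> S\<close> and that exactly one of \<open>x\<close>, \<open>- x\<close> lies in \<open>S\<close> for \<open>x \<noteq> 0\<close>, so the
  partition is determined by the finite set \<open>U\<close> of positive elements of \<open>S\<close>. Boxes are pairs
  \<open>i \<notin> S\<close>, \<open>j \<in> S\<close> with \<open>i < j\<close>, the hook length is \<open>j - i\<close>, and the sign is \<open>1\<close> iff \<open>i + j \<ge> 0\<close>; the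
  symmetry pairs the boxes of opposite sign. The powers \<open>\<alpha>\<^sub>i\<close> only account for replacing \<open>\<tau>\<close> by the
  even function \<open>\<sigma> k = \<tau> \<bar>k\<bar>\<close>. After that the hook product becomes a product over \<open>U\<close> of second-order
  quotients \<open>\<sigma> (h + g) \<sigma> (h - g) / \<sigma> h\<^sup>2\<close>.

  The quotient condition says that \<open>U\<close> is a union of chains \<open>c, c + g, \<dots>, c + (n\<^sub>c - 1) g\<close>, one for each
  pair of opposite residues modulo \<open>g\<close>, and that the coding consists of the numbers \<open>c + n\<^sub>c g - 1\<close>.
  Removing the largest element of \<open>U\<close> lowers a single \<open>n\<^sub>c\<close>; both sides of the product
  formula change by the same factor because the second-order quotients telescope along the chains.
\<close>

subsection \<open>Products over unordered pairs\<close>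

definition pair_prod :: "('b::linorder \<Rightarrow> 'b \<Rightarrow> 'a::comm_monoid_mult) \<Rightarrow> 'b set \<Rightarrow> 'a" where
  "pair_prod F A = (\<Prod>(x, y)\<in>{(x, y). x \<in> A \<and> y \<in> A \<and> x < y}. F x y)"

lemma finite_pairs: "finite A \<Longrightarrow> finite {(x, y). x \<in> A \<and> y \<in> A \<and> x < (y::'b::linorder)}"
  by (rule finite_subset[of _ "A \<times> A"]) auto

text \<open>The new element may lie on either side of the old ones. The pairs containing it are
  indexed by \<open>y\<close> through \<open>(min x y, max x y)\<close>, and the symmetry of
  \<open>F\<close> makes their orientation irrelevant.\<close>

lemma pair_prod_insert:
  assumes "finite A" "x \<notin> A" and sym: "\<And>y. y \<in> A \<Longrightarrow> F x y = F y x"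
  shows "pair_prod F (insert x A) = (\<Prod>y\<in>A. F x y) * pair_prod F A"
proof -
  let ?P = "{(x, y). x \<in> A \<and> y \<in> A \<and> x < y}" and ?f = "\<lambda>y. (min x y, max x y)"
  have inj: "inj_on ?f A"
    by (rule inj_onI) (auto simp: min_def max_def split: if_splits)
  have f_cases: "?f y = (if x < y then (x, y) else (y, x))" for y
    by (auto simp: min_def max_def)
  have "{(u, y). u \<in> insert x A \<and> y \<in> insert x A \<and> u < y} = ?f ` A \<union> ?P" (is "?L = ?R")
  proof
    show "?L \<subseteq> ?R"
    proof
      fix z assume z: "z \<in> ?L"
      show "z \<in> ?R"
      proof (cases "z \<in> ?P")
        case False
        with z obtain y where "y \<in> A" "z = (x, y) \<and> x < y \<or> z = (y, x) \<and> y < x"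
          by auto
        then have "z = ?f y" by auto
        with \<open>y \<in> A\<close> show ?thesis by blast
      qed simp
    qed
    show "?R \<subseteq> ?L"
    proof
      fix z assume "z \<in> ?R"
      then consider y where "y \<in> A" "z = ?f y" | "z \<in> ?P" by blast
      then show "z \<in> ?L"
      proof cases
        case 1
        then have "x < y \<or> y < x" using assms(2) by (metis linorder_neqE)
        then show ?thesis using 1 unfolding f_cases by auto
      qed auto
    qed
  qed
  then have "pair_prod F (insert x A) = (\<Prod>(x, y)\<in>?f ` A. F x y) * pair_prod F A"
    unfolding pair_prod_def using assms finite_pairs[OF assms(1)]
    by (subst prod.union_disjoint[symmetric]) (auto simp: min_def max_def split: if_splits)
  also have "(\<Prod>(x, y)\<in>?f ` A. F x y) = (\<Prod>y\<in>A. F x y)"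
    by (subst prod.reindex[OF inj]) (auto simp: min_def max_def sym intro!: prod.cong)
  finally show ?thesis .
qed

lemma pair_prod_empty [simp]: "pair_prod F {} = 1"
  by (simp add: pair_prod_def)

lemma pair_prod_cong:
  assumes "\<And>x y. x \<in> A \<Longrightarrow> y \<in> A \<Longrightarrow> x < y \<Longrightarrow> F x y = F' x y"
  shows "pair_prod F A = pair_prod F' A"
  unfolding pair_prod_def using assms by (auto intro!: prod.cong)

lemma pair_prod_reindex:
  assumes "finite A" "inj_on h A" and "\<And>x y. F x y = F y x"
  shows "pair_prod F (h ` A) = pair_prod (\<lambda>x y. F (h x) (h y)) A"
  using assms(1,2)
proof (induction A rule: finite_induct)
  case (insert x A)
  then have "pair_prod F (h ` insert x A) = (\<Prod>y\<in>h ` A. F (h x) y) * pair_prod F (h ` A)"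
    using assms(3) by (simp add: pair_prod_insert)
  also have "(\<Prod>y\<in>h ` A. F (h x) y) = (\<Prod>y\<in>A. F (h x) (h y))"
    using insert.prems by (subst prod.reindex) auto
  finally show ?case using insert assms(3) by (simp add: pair_prod_insert)
qed simp

lemma pair_prod_nonzero:
  fixes F :: "'b::linorder \<Rightarrow> 'b \<Rightarrow> 'a::field"
  assumes "finite A" "\<And>x y. F x y \<noteq> 0"
  shows "pair_prod F A \<noteq> 0"
  unfolding pair_prod_def using assms finite_pairs[OF assms(1)] by auto

subsection \<open>Telescoping for even weights\<close>

definition ratio :: "(int \<Rightarrow> 'a::field) \<Rightarrow> int \<Rightarrow> int \<Rightarrow> 'a" where
  "ratio \<sigma> g n = \<sigma> (n + g) / \<sigma> n"

text \<open>A multiplicative second difference with step \<open>g\<close>; the value is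
  \<open>\<sigma> (n + g) * \<sigma> (n - g) / (\<sigma> n)\<^sup>2\<close>.\<close>

definition ratio2 :: "(int \<Rightarrow> 'a::field) \<Rightarrow> int \<Rightarrow> int \<Rightarrow> 'a" where
  "ratio2 \<sigma> g n = ratio \<sigma> g n / ratio \<sigma> g (n - g)"

text \<open>With \<open>x = r + g / 2\<close> and \<open>y = s + g / 2\<close> the arguments are
  \<open>r - s\<close> and \<open>r + s\<close>: this is the factor of one pair in the product
  formula, written with integers instead of half-integers.\<close>

definition pm_prod :: "(int \<Rightarrow> 'a::field) \<Rightarrow> int \<Rightarrow> int \<Rightarrow> int \<Rightarrow> 'a" where
  "pm_prod \<sigma> g x y = \<sigma> (x - y) * \<sigma> (x + y - g)"

locale even_weight =
  fixes \<sigma> :: "int \<Rightarrow> 'a::field" and g :: int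
  assumes nonzero [simp]: "\<sigma> k \<noteq> 0"
    and even: "\<sigma> (- k) = \<sigma> k"
    and g_pos: "g \<ge> 1"
begin

abbreviation G where "G \<equiv> ratio \<sigma> g"
abbreviation T where "T \<equiv> ratio2 \<sigma> g"
abbreviation N where "N \<equiv> pm_prod \<sigma> g"

lemma G_nonzero [simp]: "G n \<noteq> 0"
  by (simp add: ratio_def)

lemma T_nonzero [simp]: "T n \<noteq> 0"
  by (simp add: ratio2_def)

lemma N_nonzero [simp]: "N x y \<noteq> 0"
  by (simp add: pm_prod_def)

lemma N_commute: "N x y = N y x"
  using even[of "x - y"] by (simp add: pm_prod_def add.commute)

text \<open>In centred coordinates the reflection is \<open>r \<mapsto> - r\<close>, which exchanges
  \<open>r - s\<close> and \<open>r + s\<close> up to sign.\<close>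

lemma N_reflect: "N (g - x) y = N x y"
  using even[of "x + y - g"] even[of "x - y"]
  by (simp add: pm_prod_def algebra_simps)

lemma N_shift: "N (p + g) w = N p w * (G (p - w) * G (p + w - g))"
  by (simp add: pm_prod_def ratio_def algebra_simps)

lemma prod_T_up: "(\<Prod>k<n. T (x + g * int k)) = G (x + g * int n - g) / G (x - g)"
  by (induction n) (auto simp: ratio2_def algebra_simps)

lemma prod_T_down: "(\<Prod>k<n. T (x - g * int k)) = G x / G (x - g * int n)"
  by (induction n) (auto simp: ratio2_def algebra_simps)

text \<open>The numerators run through \<open>{1..g}\<close> and the denominators, up to sign,
  through \<open>{0..<g}\<close>; only the two ends survive.\<close>

lemma prod_interval_shift: "(\<Prod>q\<in>{1..g}. G (1 - q)) = \<sigma> g / \<sigma> 0"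
proof -
  have a: "(\<Prod>q\<in>{1..g}. \<sigma> (1 - q + g)) = (\<Prod>q\<in>{1..g}. \<sigma> q)"
    by (rule prod.reindex_bij_witness[of _ "\<lambda>q. 1 - q + g" "\<lambda>q. 1 - q + g"]) auto
  have b: "(\<Prod>q\<in>{1..g}. \<sigma> (1 - q)) = (\<Prod>q\<in>{0..<g}. \<sigma> q)"
    using even by (intro prod.reindex_bij_witness[of _ "\<lambda>q. 1 + q" "\<lambda>q. q - 1"]) 
      (auto, metis minus_diff_eq)
  have c: "{1..g} = insert g {1..<g}" "{0..<g} = insert 0 {1..<g}"
    using g_pos by auto
  have "(\<Prod>q\<in>{1..<g}. \<sigma> q) \<noteq> 0" by simp
  then show ?thesis
    unfolding ratio_def prod_dividef a b unfolding c by simp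
qed

text \<open>Multiplication by \<open>T p\<close> slides a window of \<open>g\<close> consecutive
  arguments of \<open>G\<close> one step up, trading \<open>G (p - g)\<close> for
  \<open>G p\<close>. The window at \<open>p = 1\<close> is the one of
  \<open>prod_interval_shift\<close>.\<close>

lemma prod_T_initial:
  assumes "p \<ge> 1"
  shows "(\<Prod>q\<in>{1..<p}. T q) * (\<sigma> g / \<sigma> 0) = (\<Prod>q\<in>{1..g}. G (p - q))"
  using assms
proof (induction p rule: int_ge_induct)
  case base
  then show ?case by (simp add: prod_interval_shift)
next
  case (step p)
  have "{1..<p + 1} = insert p {1..<p}" using step by auto
  then have "(\<Prod>q\<in>{1..<p+1}. T q) * (\<sigma> g / \<sigma> 0) = T p * ((\<Prod>q\<in>{1..<p}. T q) * (\<sigma> g / \<sigma> 0))"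
    by (simp add: mult.assoc)
  also have "\<dots> = T p * (\<Prod>q\<in>{1..g}. G (p - q))" using step by simp
  also have "\<dots> = T p * (\<Prod>q\<in>insert g {1..<g}. G (p - q))"
    using g_pos by (intro arg_cong2[where f = "(*)"] prod.cong) auto
  also have "\<dots> = G p * (\<Prod>q\<in>{1..<g}. G (p - q))"
    by (simp add: ratio2_def)
  also have "(\<Prod>q\<in>{1..<g}. G (p - q)) = (\<Prod>q\<in>{2..g}. G (p + 1 - q))"
    by (rule prod.reindex_bij_witness[of _ "\<lambda>q. q - 1" "\<lambda>q. q + 1"]) (auto simp: algebra_simps)
  also have "G p * \<dots> = (\<Prod>q\<in>insert 1 {2..g}. G (p + 1 - q))"
    by simp
  also have "insert 1 {2..g} = {1..g}" using g_pos by auto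
  finally show ?case .
qed

end

section \<open>Half systems of residues and chains of beads\<close>

text \<open>A choice of one residue modulo \<open>g\<close> from each pair \<open>\<plusminus> c\<close>; the residue \<open>0\<close> is represented by \<open>g\<close>.\<close>

definition half_system :: "int \<Rightarrow> int set \<Rightarrow> bool" where
  "half_system g C \<longleftrightarrow> C \<subseteq> {1..g} \<and> g \<in> C \<and> (\<forall>c\<in>{1..<g}. c \<in> C \<longleftrightarrow> g - c \<notin> C)"

definition bead_chains :: "int \<Rightarrow> int set \<Rightarrow> (int \<Rightarrow> nat) \<Rightarrow> int set" where
  "bead_chains g C n = (\<lambda>(c, k). c + g * int k) ` Sigma C (\<lambda>c. {..<n c})"

lemma half_systemD:
  assumes "half_system g C"
  shows "C \<subseteq> {1..g}" "g \<in> C" "1 \<le> c \<Longrightarrow> c < g \<Longrightarrow> c \<in> C \<longleftrightarrow> g - c \<notin> C"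
  using assms unfolding half_system_def by (blast, blast, meson atLeastLessThan_iff)

lemma half_system_finite: "half_system g C \<Longrightarrow> finite C"
  using half_systemD(1) by (auto intro: finite_subset)

text \<open>Uniqueness of division by \<open>g\<close> with remainder in \<open>{1..g}\<close>: the
  difference of the remainders is a multiple of \<open>g\<close> smaller than \<open>g\<close> in
  absolute value.\<close>

lemma chain_coord_eq:
  fixes c c' g :: int
  assumes "c \<in> {1..g}" "c' \<in> {1..g}" "c + g * k = c' + g * k'"
  shows "c = c'" "k = k'"
proof -
  have "c - c' = g * (k' - k)" using assms(3) by (simp add: algebra_simps)
  moreover have "\<bar>c - c'\<bar> < g" using assms(1,2) by auto
  ultimately have "k' - k = 0"
    using zdvd_imp_le[of g "\<bar>c - c'\<bar>"] by force
  then show "k = k'" by simp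
  then show "c = c'" using assms(3) by simp
qed

lemma inj_chain_coord:
  assumes "C \<subseteq> {1..g}"
  shows "inj_on (\<lambda>(c, k). c + g * int k) (Sigma C (\<lambda>c. {..<n c}))"
proof (rule inj_onI, clarify)
  fix c c' and k k' :: nat
  assume "c \<in> C" "c' \<in> C" "c + g * int k = c' + g * int k'"
  then show "c = c' \<and> k = k'"
    using chain_coord_eq[of c g c' "int k" "int k'"] assms by (meson of_nat_eq_iff subsetD)
qed

lemma finite_chains: "half_system g C \<Longrightarrow> finite (bead_chains g C n)"
  using half_system_finite by (auto simp: bead_chains_def)

lemma prod_chains:
  assumes "half_system g C"
  shows "(\<Prod>p\<in>bead_chains g C n. f p) = (\<Prod>c\<in>C. \<Prod>k<n c. f (c + g * int k))"
  using assms half_system_finite[OF assms] unfolding bead_chains_def half_system_def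
  by (subst prod.reindex[OF inj_chain_coord]) (auto simp: prod.Sigma case_prod_unfold)

lemma sum_chains:
  assumes "half_system g C"
  shows "(\<Sum>p\<in>bead_chains g C n. f p) = (\<Sum>c\<in>C. \<Sum>k<n c. f (c + g * int k))"
  using assms half_system_finite[OF assms] unfolding bead_chains_def half_system_def
  by (subst sum.reindex[OF inj_chain_coord]) (auto simp: sum.Sigma case_prod_unfold)

lemma bead_chains_pos: "half_system g C \<Longrightarrow> x \<in> bead_chains g C n \<Longrightarrow> x \<ge> 1"
proof -
  assume a: "half_system g C" "x \<in> bead_chains g C n"
  then obtain c k where "c \<in> C" "x = c + g * int k" by (auto simp: bead_chains_def)
  moreover from this a have "c \<ge> 1" "g \<ge> 0" using half_systemD(1)[of g C] by auto
  then have "g * int k \<ge> 0" by simp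
  ultimately show ?thesis using \<open>c \<ge> 1\<close> by linarith
qed

text \<open>The residue \<open>g\<close> reflects to 0, which is why both end points occur; every
  other residue is chosen or is the reflection of a chosen one.\<close>

lemma half_system_union:
  assumes "half_system g C" "g \<ge> 1"
  shows "C \<union> (\<lambda>c. g - c) ` C = {0..g}" "C \<inter> (\<lambda>c. g - c) ` C = {}"
proof -
  have C: "C \<subseteq> {1..g}" "g \<in> C" "\<And>c. 1 \<le> c \<Longrightarrow> c < g \<Longrightarrow> c \<in> C \<longleftrightarrow> g - c \<notin> C"
    using half_systemD[OF assms(1)] by blast+
  show "C \<inter> (\<lambda>c. g - c) ` C = {}"
  proof -
    have False if "c \<in> C" "g - c \<in> C" for c
      using C(3)[of c] that subsetD[OF C(1), of c] subsetD[OF C(1), of "g - c"]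
      by (cases "c = g") auto
    then show ?thesis by auto
  qed
  have "x \<in> C \<union> (\<lambda>c. g - c) ` C" if "x \<in> {0..g}" for x
  proof (cases "x = 0 \<or> x = g")
    case True
    then show ?thesis using C(2) by (auto intro!: image_eqI[of _ _ g])
  next
    case False
    then show ?thesis using C(3)[of x] that by (auto intro!: image_eqI[of _ _ "g - x"])
  qed
  then show "C \<union> (\<lambda>c. g - c) ` C = {0..g}"
    using C(1) by (intro equalityI subsetI) (force, simp)
qed

section \<open>The weight of a new bead and the product over all chains\<close>

context even_weight
begin

lemma prod_half_system:
  assumes "half_system g C"
  shows "(\<Prod>c\<in>C. G (p - c) * G (p - (g - c))) = (\<Prod>q\<in>{0..g}. G (p - q))"
proof -
  note fin = half_system_finite[OF assms]
  have "(\<Prod>q\<in>{0..g}. G (p - q)) = (\<Prod>q\<in>C. G (p - q)) * (\<Prod>q\<in>(\<lambda>c. g - c) ` C. G (p - q))"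
    unfolding half_system_union(1)[OF assms g_pos, symmetric]
    using fin half_system_union(2)[OF assms g_pos] by (subst prod.union_disjoint) auto
  also have "(\<Prod>q\<in>(\<lambda>c. g - c) ` C. G (p - q)) = (\<Prod>c\<in>C. G (p - (g - c)))"
    by (subst prod.reindex) (auto simp: inj_on_def)
  finally show ?thesis by (simp add: prod.distrib)
qed

text \<open>The contribution of a positive bead \<open>p\<close> to the hook product, when \<open>A\<close> is the set of the beads in
  \<open>{1..<p}\<close>: the factors \<open>T (p - q)\<close> and \<open>T (p + q)\<close> each combine two boxes of opposite sign.\<close>

definition bead_weight :: "int \<Rightarrow> int set \<Rightarrow> 'a" where
  "bead_weight p A = \<sigma> (2 * p - g) / \<sigma> (2 * p) * G p *
     ((\<Prod>q\<in>{1..<p} - A. T (p - q)) * (\<Prod>q\<in>A. T (p + q)))"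

text \<open>Putting the bead \<open>p\<close> on the chain of \<open>c0\<close> moves the end of
  that chain from \<open>p\<close> to \<open>p + g\<close>. The \<open>T\<close> factors telescope
  along every chain to its two ends; the lower ends cancel because a half system and its reflection
  fill \<open>{0..g}\<close>, and the upper ends give the quotients from
  \<open>N_shift\<close>.\<close>

lemma bead_weight_chains:
  assumes hs: "half_system g C" and c0: "c0 \<in> C" and p: "p = c0 + g * int (n c0)"
    and sub: "bead_chains g C n \<subseteq> {1..<p}"
  shows "bead_weight p (bead_chains g C n) * (\<Prod>c\<in>C - {c0}. N p (c + g * int (n c))) =
     (\<Prod>c\<in>C - {c0}. N (p + g) (c + g * int (n c)))"
proof -
  note fin = half_system_finite[OF hs]
  define w where "w c = c + g * int (n c)" for c
  let ?U = "bead_chains g C n"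
  have finU: "finite ?U" by (rule finite_chains[OF hs])
  have p1: "p \<ge> 1"
  proof -
    have "c0 \<ge> 1" using half_systemD(1)[OF hs] c0 by auto
    moreover have "g * int (n c0) \<ge> 0" using g_pos by simp
    ultimately show ?thesis using p by linarith
  qed
  have "{1..<p} = ({1..<p} - ?U) \<union> ?U" using sub by auto
  then have "(\<Prod>q\<in>{1..<p}. T (p - q)) = (\<Prod>q\<in>{1..<p} - ?U. T (p - q)) * (\<Prod>q\<in>?U. T (p - q))"
    using finU by (metis Diff_disjoint finite_Diff finite_atLeastLessThan_int inf_commute prod.union_disjoint)
  moreover have "(\<Prod>q\<in>{1..<p}. T (p - q)) = (\<Prod>q\<in>{1..<p}. T q)"
    by (rule prod.reindex_bij_witness[of _ "\<lambda>q. p - q" "\<lambda>q. p - q"]) auto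
  moreover have nz: "(\<Prod>q\<in>?U. T (p - q)) \<noteq> 0" using finU by simp
  \<comment> \<open>The product over the gaps is the product over all of \<open>{1..<p}\<close>,
    known from \<open>prod_T_initial\<close>, divided by the product over the beads.\<close>
  ultimately have 1: "(\<Prod>q\<in>{1..<p} - ?U. T (p - q)) =
      (\<Prod>q\<in>{1..g}. G (p - q)) * (\<sigma> 0 / \<sigma> g) / (\<Prod>q\<in>?U. T (p - q))"
    using prod_T_initial[OF p1] by (simp add: field_simps)
  have 2: "(\<Prod>q\<in>?U. T (p + q)) = (\<Prod>c\<in>C. G (p + w c - g) / G (p + c - g))"
    unfolding prod_chains[OF hs] w_def
    by (intro prod.cong refl) (use prod_T_up[of "p + _"] in \<open>simp add: add.assoc\<close>)
  have 3: "(\<Prod>q\<in>?U. T (p - q)) = (\<Prod>c\<in>C. G (p - c) / G (p - w c))"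
    unfolding prod_chains[OF hs] w_def
    by (intro prod.cong refl) (use prod_T_down[of "p - _"] in \<open>simp add: diff_diff_eq\<close>)
  \<comment> \<open>The chain starts leave \<open>G (p - c) * G (p + c - g)\<close> in the
    denominator; over the half system these multiply to the window product on the left.\<close>
  have 4: "(\<Prod>q\<in>?U. T (p + q)) / (\<Prod>q\<in>?U. T (p - q)) * (\<Prod>q\<in>{0..g}. G (p - q)) =
     (\<Prod>c\<in>C. G (p - w c) * G (p + w c - g))"
    unfolding 2 3 prod_half_system[OF hs, symmetric] prod_dividef[symmetric] prod.distrib[symmetric]
    by (intro prod.cong refl) (simp add: algebra_simps)
  \<comment> \<open>The chain of \<open>c0\<close> ends at \<open>p\<close> itself. Its two factors
    \<open>G 0\<close> and \<open>G (2 * p - g)\<close> cancel the prefactors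
    \<open>\<sigma> 0 / \<sigma> g\<close> and
    \<open>\<sigma> (2 * p - g) / \<sigma> (2 * p)\<close>.\<close>
  have "(\<Prod>c\<in>C. G (p - w c) * G (p + w c - g)) =
     G 0 * G (2 * p - g) * (\<Prod>c\<in>C - {c0}. G (p - w c) * G (p + w c - g))"
    using p by (subst prod.remove[OF fin c0]) (simp add: w_def)
  moreover have "{0..g} = insert 0 {1..g}" using g_pos by auto
  then have "(\<Prod>q\<in>{0..g}. G (p - q)) = G p * (\<Prod>q\<in>{1..g}. G (p - q))" by simp
  ultimately have 5: "(\<Prod>q\<in>?U. T (p + q)) / (\<Prod>q\<in>?U. T (p - q)) * (G p * (\<Prod>q\<in>{1..g}. G (p - q))) =
      G 0 * G (2 * p - g) * (\<Prod>c\<in>C - {c0}. G (p - w c) * G (p + w c - g))"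
    using 4 by simp
  have "bead_weight p ?U = \<sigma> (2 * p - g) / \<sigma> (2 * p) * (\<sigma> 0 / \<sigma> g) *
      ((\<Prod>q\<in>?U. T (p + q)) / (\<Prod>q\<in>?U. T (p - q)) * (G p * (\<Prod>q\<in>{1..g}. G (p - q))))"
    unfolding bead_weight_def 1 by (simp add: mult_ac)
  also have "\<dots> = (\<Prod>c\<in>C - {c0}. G (p - w c) * G (p + w c - g))"
    unfolding 5 by (simp add: ratio_def)
  finally have "bead_weight p ?U = (\<Prod>c\<in>C - {c0}. G (p - w c) * G (p + w c - g))" .
  then show ?thesis
    unfolding w_def N_shift by (simp add: prod.distrib mult.commute)
qed

definition bead_prod :: "int set \<Rightarrow> 'a" where
  "bead_prod U = (\<Prod>p\<in>U. bead_weight p (U \<inter> {1..<p}))"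

text \<open>The weight of a bead depends only on the beads below it, so a new largest bead leaves
  the other weights unchanged.\<close>

lemma bead_prod_insert_max:
  assumes "finite U" "U \<subseteq> {1..<p}"
  shows "bead_prod (insert p U) = bead_weight p U * bead_prod U"
proof -
  have "p \<notin> U" using assms by auto
  moreover have "insert p U \<inter> {1..<p} = U" using assms by auto
  moreover have "insert p U \<inter> {1..<q} = U \<inter> {1..<q}" if "q \<in> U" for q
    using assms that by auto
  ultimately show ?thesis
    unfolding bead_prod_def using assms by (simp cong: prod.cong)
qed

text \<open>Induction on the number of beads, removing the largest one. \<open>pair_prod N C\<close>
  is the right-hand side for empty chains and serves as the normalisation.\<close>

lemma bead_prod_chains:
  assumes hs: "half_system g C"
  shows "bead_prod (bead_chains g C n) * pair_prod N C = pair_prod (\<lambda>c d. N (c + g * int (n c)) (d + g * int (n d))) C"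
proof (induction "card (bead_chains g C n)" arbitrary: n)
  case 0
  have n0: "n c = 0" if "c \<in> C" for c
  proof (rule ccontr)
    assume "n c \<noteq> 0"
    then have "c + g * int 0 \<in> bead_chains g C n" using that
      unfolding bead_chains_def by (intro image_eqI[of _ _ "(c, 0)"]) auto
    then show False using 0 finite_chains[OF hs] by auto
  qed
  have "bead_chains g C n = {}" using 0 finite_chains[OF hs] by auto
  then show ?case using n0 by (auto simp: bead_prod_def intro!: pair_prod_cong)
next
  case (Suc m)
  note fin = half_system_finite[OF hs] and finU = finite_chains[OF hs, of n]
  note C = half_systemD(1)[OF hs]
  define p where "p = Max (bead_chains g C n)"
  have "p \<in> bead_chains g C n" using Suc(2) finU unfolding p_def by (intro Max_in) auto
  then obtain c0 k where c0: "c0 \<in> C" "k < n c0" "p = c0 + g * int k" by (auto simp: bead_chains_def)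
  \<comment> \<open>The largest bead is the last one of its chain, so its removal leaves chains
    again.\<close>
  have "\<not> Suc k < n c0"
  proof
    assume "Suc k < n c0"
    then have "c0 + g * int (Suc k) \<in> bead_chains g C n" using c0(1)
      unfolding bead_chains_def by (intro image_eqI[of _ _ "(c0, Suc k)"]) auto
    then have "c0 + g * int (Suc k) \<le> p" using finU unfolding p_def by simp
    then show False using c0 g_pos by (simp add: algebra_simps)
  qed
  then have k: "n c0 = Suc k" using c0 by auto
  define n' where "n' = n(c0 := k)"
  have "Sigma C (\<lambda>c. {..<n c}) = insert (c0, k) (Sigma C (\<lambda>c. {..<n' c}))"
    using c0 k by (auto simp: n'_def split: if_splits)
  then have ins: "bead_chains g C n = insert p (bead_chains g C n')"
    unfolding bead_chains_def using c0 by simp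
  have pn: "p \<notin> bead_chains g C n'"
  proof
    assume "p \<in> bead_chains g C n'"
    then obtain c j where c: "c \<in> C" "j < n' c" "p = c + g * int j" by (auto simp: bead_chains_def)
    then have "c = c0" "int j = int k" using chain_coord_eq[of c g c0 "int j" "int k"] c0 C by (metis subsetD)+
    then show False using c by (simp add: n'_def)
  qed
  have sub: "bead_chains g C n' \<subseteq> {1..<p}"
  proof
    fix x assume x: "x \<in> bead_chains g C n'"
    then have "x \<le> p" using ins finU unfolding p_def by (metis Max_ge insertI2)
    then show "x \<in> {1..<p}" using x pn bead_chains_pos[OF hs x] by (cases "x = p") auto
  qed
  note finU' = finite_chains[OF hs, of n']
  have "m = card (bead_chains g C n')" using Suc(2) ins pn finU' by simp
  note IH = Suc(1)[OF this]
  define w where "w c = c + g * int (n c)" for c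
  define w' where "w' c = c + g * int (n' c)" for c
  have ww: "w c = w' c" if "c \<in> C - {c0}" for c using that by (simp add: w_def w'_def n'_def)
  have w0: "w' c0 = p" "w c0 = p + g" using c0 k by (auto simp: w_def w'_def n'_def algebra_simps)
  let ?D = "C - {c0}"
  have CD: "C = insert c0 ?D" using c0 by auto
  \<comment> \<open>Only the pairs containing \<open>c0\<close> change when \<open>p\<close> is
    removed; they are split off.\<close>
  have pp: "pair_prod (\<lambda>c d. N (f c) (f d)) C = (\<Prod>d\<in>?D. N (f c0) (f d)) * pair_prod (\<lambda>c d. N (f c) (f d)) ?D" for f
    using fin by (subst CD, subst pair_prod_insert) (auto simp: N_commute)
  have eqD: "pair_prod (\<lambda>c d. N (w c) (w d)) ?D = pair_prod (\<lambda>c d. N (w' c) (w' d)) ?D"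
    by (rule pair_prod_cong) (simp add: ww)
  have "bead_weight p (bead_chains g C n') * (\<Prod>d\<in>?D. N p (w' d)) = (\<Prod>d\<in>?D. N (p + g) (w' d))"
    unfolding w'_def by (rule bead_weight_chains[OF hs c0(1) _ sub]) (use c0 in \<open>simp add: n'_def\<close>)
  also have "\<dots> = (\<Prod>d\<in>?D. N (w c0) (w d))" using w0 by (intro prod.cong) (auto simp: ww)
  finally have step: "bead_weight p (bead_chains g C n') * (\<Prod>d\<in>?D. N p (w' d)) = (\<Prod>d\<in>?D. N (w c0) (w d))" .
  have "bead_prod (bead_chains g C n) * pair_prod N C =
     bead_weight p (bead_chains g C n') * pair_prod (\<lambda>c d. N (w' c) (w' d)) C"
    unfolding ins bead_prod_insert_max[OF finU' sub] w'_def IH[symmetric] by (simp add: mult.assoc)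
  also have "\<dots> = (bead_weight p (bead_chains g C n') * (\<Prod>d\<in>?D. N p (w' d))) *
     pair_prod (\<lambda>c d. N (w' c) (w' d)) ?D"
    unfolding pp w0 by (simp add: mult.assoc)
  also have "\<dots> = (\<Prod>d\<in>?D. N (w c0) (w d)) * pair_prod (\<lambda>c d. N (w c) (w d)) ?D"
    unfolding eqD step ..
  also have "\<dots> = pair_prod (\<lambda>c d. N (w c) (w d)) C"
    unfolding pp ..
  finally show ?case unfolding w_def .
qed

end

section \<open>Independence of the half system and the sum of the beads\<close>

text \<open>The reflection \<open>c \<mapsto> g - c\<close> fixes both \<open>N\<close> and \<open>(c - g / 2)\<^sup>2\<close>, hence the choice made by the half
  system is irrelevant.\<close>

lemma fold_half_system:
  assumes "half_system g C" "g = 2 * t - 1" "t \<ge> 1"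
  defines "h \<equiv> (\<lambda>c. if 2 * c < g then g - c else c)"
  shows "inj_on h C" "h ` C = {t..g}"
proof -
  have C: "C \<subseteq> {1..g}" "g \<in> C" "\<And>c. 1 \<le> c \<Longrightarrow> c < g \<Longrightarrow> c \<in> C \<longleftrightarrow> g - c \<notin> C"
    using half_systemD[OF assms(1)] by blast+
  \<comment> \<open>A half system never contains two distinct residues that are reflections of each
    other.\<close>
  have c': "c = d" if "c \<in> C" "d \<in> C" "2 * c < g" "g - c = d" for c d
    using that C(3)[of c] subsetD[OF C(1), of c] by auto
  show "inj_on h C"
    using c' unfolding h_def by (intro inj_onI) (auto split: if_splits)
  show "h ` C = {t..g}"
  proof
    show "h ` C \<subseteq> {t..g}" using C(1) assms(2) by (auto simp: h_def)
    show "{t..g} \<subseteq> h ` C"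
    proof
      fix x assume x: "x \<in> {t..g}"
      show "x \<in> h ` C"
      proof (cases "x \<in> C")
        case True
        then show ?thesis using x assms(2) by (intro image_eqI[of _ _ x]) (auto simp: h_def)
      next
        case False
        then have "x < g" using x C(2) by (cases "x = g") auto
        then have "g - x \<in> C" using False C(3)[of x] x assms(2,3) by auto
        then show ?thesis using x assms(2) by (intro image_eqI[of _ _ "g - x"]) (auto simp: h_def)
      qed
    qed
  qed
qed

text \<open>The consecutive residues \<open>t, \<dots>, g\<close> produce the denominators of the
  product formula.\<close>

lemma (in even_weight) pair_prod_half_system:
  assumes "half_system g C" "g = 2 * t - 1" "t \<ge> 1"
  shows "pair_prod N C = pair_prod N {t..g}"
proof -
  define h where "h = (\<lambda>c. if 2 * c < g then g - c else c)"
  have "N (h c) (h d) = N c d" for c d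
    using N_reflect N_commute by (simp add: h_def)
  then have "pair_prod N C = pair_prod (\<lambda>c d. N (h c) (h d)) C" by simp
  also have "\<dots> = pair_prod N (h ` C)"
    using half_system_finite[OF assms(1)] fold_half_system(1)[OF assms] N_commute
    by (intro pair_prod_reindex[symmetric]) (auto simp: h_def)
  finally show ?thesis using fold_half_system(2)[OF assms] by (simp add: h_def)
qed

text \<open>Since \<open>t - g / 2 = 1 / 2\<close>, these are the squares of the first
  \<open>t\<close> positive half-odd numbers; they give the constant of the size formula.\<close>

lemma sum_squares_centered:
  fixes t :: int
  assumes "t \<ge> 1" "g = 2 * t - 1"
  shows "(\<Sum>x\<in>{t..g}. (real_of_int x - real_of_int g / 2)\<^sup>2) = real_of_int g * (real_of_int g + 2) * (real_of_int t) / 12"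
proof -
  have *: "(\<Sum>k<m. (real k + 1/2)\<^sup>2) = real m * (4 * (real m)\<^sup>2 - 1) / 12" for m
    by (induction m) (auto simp: power2_eq_square field_simps)
  have "(\<Sum>x\<in>{t..g}. (real_of_int x - real_of_int g / 2)\<^sup>2) = (\<Sum>k<nat t. (real k + 1/2)\<^sup>2)"
    using assms by (intro sum.reindex_bij_witness[of _ "\<lambda>k. t + int k" "\<lambda>x. nat (x - t)"])
      (auto simp: field_simps)
  also have "\<dots> = real_of_int g * (real_of_int g + 2) * (real_of_int t) / 12"
    unfolding * assms(2) using assms(1) by (simp add: power2_eq_square algebra_simps)
  finally show ?thesis .
qed

text \<open>Along a chain, \<open>2 * g * x\<close> is the difference of
  \<open>(x + g - g / 2)\<^sup>2\<close> and \<open>(x - g / 2)\<^sup>2\<close>, so the sum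
  telescopes. The starting squares are invariant under reflection, hence known from
  \<open>sum_squares_centered\<close>.\<close>

lemma sum_chains_double:
  assumes "half_system g C" "g = 2 * t - 1" "t \<ge> 1"
  shows "real_of_int (\<Sum>p\<in>bead_chains g C n. 2 * p) =
    1 / real_of_int g * (\<Sum>c\<in>C. (real_of_int (c + g * int (n c)) - real_of_int g / 2)\<^sup>2)
    - (real_of_int g + 2) * real_of_int t / 12"
proof -
  have one: "real_of_int g * (\<Sum>k<m. 2 * (real_of_int c + real_of_int g * real k)) =
    (real_of_int (c + g * int m) - real_of_int g / 2)\<^sup>2 - (real_of_int c - real_of_int g / 2)\<^sup>2" for c m
    by (induction m) (auto simp: power2_eq_square field_simps)
  define h where "h = (\<lambda>c. if 2 * c < g then g - c else c)"
  have "(\<Sum>c\<in>C. (real_of_int c - real_of_int g / 2)\<^sup>2) = (\<Sum>c\<in>C. (real_of_int (h c) - real_of_int g / 2)\<^sup>2)"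
    by (intro sum.cong refl) (auto simp: h_def power2_eq_square algebra_simps)
  also have "\<dots> = (\<Sum>x\<in>h ` C. (real_of_int x - real_of_int g / 2)\<^sup>2)"
    using fold_half_system(1)[OF assms] by (subst sum.reindex) (auto simp: h_def)
  also have "h ` C = {t..g}" using fold_half_system(2)[OF assms] by (simp add: h_def)
  finally have base: "(\<Sum>c\<in>C. (real_of_int c - real_of_int g / 2)\<^sup>2) =
      real_of_int g * (real_of_int g + 2) * (real_of_int t) / 12"
    using sum_squares_centered[OF assms(3,2)] by simp
  have "real_of_int g * real_of_int (\<Sum>p\<in>bead_chains g C n. 2 * p) =
     (\<Sum>c\<in>C. real_of_int g * (\<Sum>k<n c. 2 * (real_of_int c + real_of_int g * real k)))"
    unfolding sum_chains[OF assms(1)] by (simp add: sum_distrib_left)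
  also have "\<dots> = (\<Sum>c\<in>C. (real_of_int (c + g * int (n c)) - real_of_int g / 2)\<^sup>2)
     - real_of_int g * (real_of_int g + 2) * (real_of_int t) / 12"
    unfolding one sum_subtractf base ..
  finally have *: "real_of_int g * X = Y - real_of_int g * (real_of_int g + 2) * (real_of_int t) / 12"
    if "X = real_of_int (\<Sum>p\<in>bead_chains g C n. 2 * p)"
      "Y = (\<Sum>c\<in>C. (real_of_int (c + g * int (n c)) - real_of_int g / 2)\<^sup>2)" for X Y
    unfolding that .
  have "X = 1 / real_of_int g * Y - (real_of_int g + 2) * (real_of_int t) / 12"
    if "X = real_of_int (\<Sum>p\<in>bead_chains g C n. 2 * p)"
      "Y = (\<Sum>c\<in>C. (real_of_int (c + g * int (n c)) - real_of_int g / 2)\<^sup>2)" for X Y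
  proof -
    have "real_of_int g > 0" using assms(2,3) by simp
    then show ?thesis using *[OF that] by (simp add: field_simps)
  qed
  then show ?thesis by blast
qed

subsection \<open>Bead sets of partitions\<close>

lemma part_conjugate:
  assumes "j \<ge> 1"
  shows "part (conjugate l) j = (if j \<le> part l 1 then card {i. 1 \<le> i \<and> i \<le> length l \<and> part l i \<ge> j} else 0)"
  using assms unfolding part_def[of "conjugate l"] by (auto simp: conjugate_def simp del: upt_Suc)

text \<open>Both sides say that the box \<open>(i, j)\<close> is in the diagram: the rows meeting
  column \<open>j\<close> form an initial segment because the parts decrease.\<close>

lemma le_part_conjugate_iff:
  assumes "is_partition l" "i \<ge> 1" "j \<ge> 1"
  shows "i \<le> part (conjugate l) j \<longleftrightarrow> j \<le> part l i"
proof -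
  let ?A = "{i. 1 \<le> i \<and> i \<le> length l \<and> part l i \<ge> j}"
  have len: "k \<le> length l" if "j \<le> part l k" for k
    using that assms(3) by (auto simp: part_def split: if_splits)
  have fin: "finite ?A" by (rule finite_subset[of _ "{..length l}"]) auto
  show ?thesis
  proof (cases "j \<le> part l 1")
    case False
    then show ?thesis
      using assms part_antimono[OF assms(1), of 1 i] by (simp add: part_conjugate)
  next
    case True
    show ?thesis
    proof
      assume "j \<le> part l i"
      then have "{1..i} \<subseteq> ?A"
        using part_antimono[OF assms(1)] len by (auto intro: order_trans le_trans)
      from card_mono[OF fin this] show "i \<le> part (conjugate l) j"
        using True assms by (simp add: part_conjugate)
    next
      assume *: "i \<le> part (conjugate l) j"
      show "j \<le> part l i"
      proof (rule ccontr)
        assume "\<not> j \<le> part l i"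
        then have "?A \<subseteq> {1..<i}"
          using part_antimono[OF assms(1,2)] by (auto simp: not_le[symmetric] intro: order_trans)
        from card_mono[OF _ this] show False
          using * True assms by (simp add: part_conjugate)
      qed
    qed
  qed
qed

lemma is_partition_conjugate:
  assumes "is_partition l"
  shows "is_partition (conjugate l)"
proof -
  let ?f = "\<lambda>j. card {i. 1 \<le> i \<and> i \<le> length l \<and> part l i \<ge> j}"
  have fin: "finite {i. 1 \<le> i \<and> i \<le> length l \<and> part l i \<ge> j}" for j
    by (rule finite_subset[of _ "{..length l}"]) auto
  have anti: "?f j \<le> ?f i" if "i \<le> j" for i j
    using that by (intro card_mono fin) auto
  have pos: "?f j > 0" if "1 \<le> j" "j \<le> part l 1" for j
  proof -
    have "1 \<in> {i. 1 \<le> i \<and> i \<le> length l \<and> part l i \<ge> j}"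
      using that by (auto simp: part_def split: if_splits)
    then show ?thesis using fin[of j] card_gt_0_iff by blast
  qed
  have "sorted_wrt (\<ge>) (conjugate l)"
    unfolding conjugate_def sorted_wrt_map
    by (rule sorted_wrt_mono_rel[of _ "(\<le>)"]) (use anti in \<open>auto simp del: upt_Suc\<close>)
  moreover have "\<forall>x\<in>set (conjugate l). x > 0"
    unfolding conjugate_def using pos by (auto simp del: upt_Suc)
  ultimately show ?thesis by (simp add: is_partition_def)
qed

lemma part_conjugate_conjugate:
  assumes "is_partition l" "i \<ge> 1"
  shows "part (conjugate (conjugate l)) i = part l i"
proof -
  have "k \<le> part (conjugate (conjugate l)) i \<longleftrightarrow> k \<le> part l i" if "k \<ge> 1" for k
    using le_part_conjugate_iff[OF is_partition_conjugate[OF assms(1)] that assms(2)]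
      le_part_conjugate_iff[OF assms(1,2) that] by simp
  then show ?thesis
    by (metis One_nat_def Suc_leI le0 le_antisym neq0_conv order_refl)
qed

text \<open>The index, raised by one, of the vertical step at the end of row \<open>r\<close>.
  Likewise \<open>col_pos\<close> belongs to the horizontal step at the foot of column
  \<open>c\<close>.\<close>

definition row_pos :: "nat list \<Rightarrow> nat \<Rightarrow> int" where
  "row_pos l r = int (part l r) - int r + 1"

definition col_pos :: "nat list \<Rightarrow> nat \<Rightarrow> int" where
  "col_pos l c = int c - int (part (conjugate l) c)"

text \<open>The shift by one against \<^const>\<open>word\<close> puts the centre of symmetry for \<^const>\<open>DD'\<close> at 0.\<close>

definition maya :: "nat list \<Rightarrow> int set" where
  "maya l = row_pos l ` {1..}"

lemma maya_word: "x \<in> maya l \<longleftrightarrow> word l (x - 1) = 0"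
proof -
  have "x = int (part l r) - int r + 1 \<longleftrightarrow> x - 1 = int (part l r) - int r" for r by auto
  then show ?thesis by (auto simp: maya_def row_pos_def word_def image_iff Bex_def)
qed

lemma boxes_iff: "(r, c) \<in> boxes l \<longleftrightarrow> r \<ge> 1 \<and> c \<ge> 1 \<and> c \<le> part l r"
  by (auto simp: boxes_def part_def)

lemma hook_length_pos: "hook_length l (r, c) = row_pos l r - col_pos l c"
  by (simp add: hook_length_def row_pos_def col_pos_def)

lemma finite_boxes: "finite (boxes l)"
proof (rule finite_subset)
  show "boxes l \<subseteq> Sigma {1..length l} (\<lambda>i. {1..part l i})" by (auto simp: boxes_def)
qed auto

lemma sum_list_eq_card_boxes: "sum_list l = card (boxes l)"
proof -
  have "boxes l = Sigma {1..length l} (\<lambda>i. {1..part l i})" by (auto simp: boxes_def)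
  then have "card (boxes l) = (\<Sum>i\<in>{1..length l}. part l i)" by simp
  also have "\<dots> = (\<Sum>i<length l. l ! i)"
    by (rule sum.reindex_bij_witness[of _ Suc "\<lambda>i. i - 1"]) (auto simp: part_def)
  finally show ?thesis by (simp add: sum_list_sum_nth atLeast0LessThan)
qed

context
  fixes l :: "nat list"
  assumes part: "is_partition l"
begin

lemma row_pos_less: "1 \<le> i \<Longrightarrow> i < j \<Longrightarrow> row_pos l j < row_pos l i"
  using part_antimono[OF part, of i j] by (simp add: row_pos_def)

lemma col_pos_less: "1 \<le> i \<Longrightarrow> i < j \<Longrightarrow> col_pos l i < col_pos l j"
  using part_antimono[OF is_partition_conjugate[OF part], of i j] by (simp add: col_pos_def)

lemma row_pos_less_iff: "1 \<le> i \<Longrightarrow> 1 \<le> j \<Longrightarrow> row_pos l j < row_pos l i \<longleftrightarrow> i < j"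
  by (metis linorder_neqE_nat not_less_iff_gr_or_eq row_pos_less)

lemma inj_row_pos: "inj_on (row_pos l) {1..}"
  by (rule inj_onI) (metis atLeast_iff linorder_neqE_nat less_irrefl row_pos_less)

lemma inj_col_pos: "inj_on (col_pos l) {1..}"
  by (rule inj_onI) (metis atLeast_iff linorder_neqE_nat less_irrefl col_pos_less)

text \<open>The difference of the positions is the hook length, at least 1 inside the diagram;
  outside, the same expression is at most -1, so it never vanishes.\<close>

lemma box_iff_pos:
  assumes "r \<ge> 1" "c \<ge> 1"
  shows "c \<le> part l r \<longleftrightarrow> col_pos l c < row_pos l r" and "col_pos l c \<noteq> row_pos l r"
  using le_part_conjugate_iff[OF part assms]
  by (cases "c \<le> part l r"; simp add: col_pos_def row_pos_def)+

lemma col_pos_range: "col_pos l ` {1..} = - maya l"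
proof
  show "col_pos l ` {1..} \<subseteq> - maya l"
    using box_iff_pos(2) by (auto simp: maya_def)
  show "- maya l \<subseteq> col_pos l ` {1..}"
  proof
    fix x assume x: "x \<in> - maya l"
    then have nx: "row_pos l r \<noteq> x" if "r \<ge> 1" for r using that by (auto simp: maya_def)
    define P where "P r \<longleftrightarrow> r \<ge> 1 \<and> row_pos l r < x" for r
    have "P (length l + nat \<bar>x\<bar> + 2)"
      by (simp add: P_def row_pos_def part_def)
    \<comment> \<open>The first row whose step comes before \<open>x\<close>. The column through
      \<open>x\<close> then has exactly \<open>r - 1\<close> boxes, which determines
      \<open>c\<close>.\<close>
    define r where "r = (LEAST r. P r)"
    have r: "P r" unfolding r_def by (rule LeastI) fact
    have c1: "x + int r - 1 \<ge> 1" using r by (simp add: P_def row_pos_def)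
    define c where "c = nat (x + int r - 1)"
    have c: "int c = x + int r - 1" "c \<ge> 1" using c1 by (auto simp: c_def)
    have "\<not> c \<le> part l r" using r c by (simp add: P_def row_pos_def)
    then have less: "part (conjugate l) c < r"
      using le_part_conjugate_iff[OF part _ c(2), of r] r by (simp add: P_def)
    have "r - 1 \<le> part (conjugate l) c"
    proof (cases "r = 1")
      case False
      then have r1: "r - 1 \<ge> 1" using r unfolding P_def by linarith
      have "\<not> P (r - 1)" using not_less_Least[of "r - 1" P] r1 unfolding r_def by simp
      then have "row_pos l (r - 1) > x" using r1 nx[OF r1] by (simp add: P_def)
      then have "c \<le> part l (r - 1)" using c r1 by (simp add: row_pos_def)
      then show ?thesis using le_part_conjugate_iff[OF part r1 c(2)] by simp
    qed simp
    then have "int (part (conjugate l) c) = int r - 1" using less by linarith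
    then show "x \<in> col_pos l ` {1..}"
      using c by (intro image_eqI[of _ _ c]) (simp_all add: col_pos_def)
  qed
qed

end

section \<open>The symmetry of the bead set for \<open>DD'\<close>\<close>

lemma durfee_props:
  shows "part l (durfee l) \<ge> durfee l" and "part l s \<ge> s \<Longrightarrow> s \<le> durfee l"
proof -
  have "{s. part l s \<ge> s} \<subseteq> {..length l}" by (auto simp: part_def split: if_splits)
  then have fin: "finite {s. part l s \<ge> s}" by (rule finite_subset) simp
  have "0 \<in> {s. part l s \<ge> s}" by simp
  then have "Max {s. part l s \<ge> s} \<in> {s. part l s \<ge> s}" using fin Max_in by blast
  then show "part l (durfee l) \<ge> durfee l" by (simp add: durfee_def)
  show "part l s \<ge> s \<Longrightarrow> s \<le> durfee l" unfolding durfee_def using fin by simp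
qed

text \<open>Here \<open>d\<close> is the Durfee size of the conjugate \<open>m\<close>. The
  condition of \<open>DD\<close> makes column \<open>r\<close> of \<open>l\<close> one box longer
  than row \<open>r\<close> for \<open>r \<le> d\<close>, which negates the position.\<close>

lemma DD'_structure:
  assumes "l \<in> DD'"
  obtains d where "is_partition l" "\<And>r. 1 \<le> r \<Longrightarrow> r \<le> d \<Longrightarrow> row_pos l r > 0"
    "row_pos l (d + 1) = 0" "\<And>r. 1 \<le> r \<Longrightarrow> r \<le> d \<Longrightarrow> col_pos l r = - row_pos l r"
    "\<And>c. c > d \<Longrightarrow> col_pos l c > 0"
proof -
  obtain m where m: "l = conjugate m" "m \<in> DD" using assms by (auto simp: DD'_def)
  have pm: "is_partition m" using m by (simp add: DD_def)
  have pl: "is_partition l" using is_partition_conjugate[OF pm] m by simp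
  define d where "d = durfee m"
  have conj: "part (conjugate l) c = part m c" if "c \<ge> 1" for c
    using part_conjugate_conjugate[OF pm that] m by simp
  have md: "part m r = part l r + 1" if "1 \<le> r" "r \<le> d" for r
    using that m by (auto simp: DD_def d_def)
  have box: "c \<le> part l r \<longleftrightarrow> r \<le> part m c" if "r \<ge> 1" "c \<ge> 1" for r c
    using le_part_conjugate_iff[OF pm that(2,1)] m by simp
  have ge: "part l r \<ge> d" if "1 \<le> r" "r \<le> d" for r
  proof -
    have "d \<le> part m d" using durfee_props(1)[of m] by (simp add: d_def)
    then have "d \<le> part l d" using box[of d d] that by auto
    then show ?thesis using part_antimono[OF pl that] by simp
  qed
  have out: "\<not> d + 1 \<le> part m (d + 1)"
    using durfee_props(2)[of "d + 1" m] by (auto simp: d_def)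
  then have out': "\<not> d + 1 \<le> part l (d + 1)" using box[of "d + 1" "d + 1"] by simp
  \<comment> \<open>For \<open>d > 0\<close>, column \<open>d\<close> has more than \<open>d\<close>
    boxes and so reaches row \<open>d + 1\<close>. This row supplies the bead at 0.\<close>
  have "part l (d + 1) = d"
  proof (cases "d = 0")
    case False
    then have "d + 1 \<le> part m d" using md[of d] ge[of d] by simp
    then have "d \<le> part l (d + 1)" using box[of "d + 1" d] False by simp
    then show ?thesis using out' by simp
  qed (use out' in simp)
  moreover have "part m c \<le> d" if "c > d" for c
    using part_antimono[OF pm, of "d + 1" c] that out by simp
  ultimately show ?thesis
    using ge md conj
    by (intro that[of d] pl)
       (force simp: row_pos_def col_pos_def)+
qed

definition pos_beads :: "nat list \<Rightarrow> int set" where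
  "pos_beads l = {x \<in> maya l. x > 0}"

lemma diag_sign_eq: "diag_sign (r, c) = (if c < r then - 1 else 1)"
  by (simp add: diag_sign_def)

text \<open>Boxes of sign 1 lie in the first \<open>d\<close> rows, the others in the first
  \<open>d\<close> columns. A box of the first kind is assigned to the bead of its row, one of the
  second kind to the bead opposite to its column.\<close>

lemma maya_DD':
  assumes "l \<in> DD'"
  shows "0 \<in> maya l" and "x \<noteq> 0 \<Longrightarrow> x \<in> maya l \<longleftrightarrow> - x \<notin> maya l"
    and "finite (pos_beads l)"
    and "bij_betw (\<lambda>(r, c). (row_pos l r, - col_pos l c)) {s \<in> boxes l. diag_sign s = 1}
           (Sigma (pos_beads l) (\<lambda>p. {x \<in> {- p<..p}. - x \<notin> maya l}))"
    and "bij_betw (\<lambda>(r, c). (- col_pos l c, row_pos l r)) {s \<in> boxes l. diag_sign s \<noteq> 1}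
           (Sigma (pos_beads l) (\<lambda>p. {x \<in> {- p<..<p}. x \<in> maya l}))"
proof -
  obtain d where pl: "is_partition l" and d: "\<And>r. 1 \<le> r \<Longrightarrow> r \<le> d \<Longrightarrow> row_pos l r > 0"
    "row_pos l (d + 1) = 0" "\<And>r. 1 \<le> r \<Longrightarrow> r \<le> d \<Longrightarrow> col_pos l r = - row_pos l r"
    "\<And>c. c > d \<Longrightarrow> col_pos l c > 0"
    using DD'_structure[OF assms] by blast
  have neg: "row_pos l r < 0" if "r > d + 1" for r
    using row_pos_less[OF pl, of "d + 1" r] that d(2) by simp
  have row_pos_iff: "row_pos l r > 0 \<longleftrightarrow> r \<le> d" if "r \<ge> 1" for r
    using that d(1)[of r] d(2) neg[of r] by (cases "r \<le> d"; cases "r = d + 1") auto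
  have beads: "pos_beads l = row_pos l ` {1..d}"
    using row_pos_iff by (auto simp: pos_beads_def maya_def)
  show "finite (pos_beads l)" by (simp add: beads)
  show zero: "0 \<in> maya l" using d(2) by (force simp: maya_def)
  note range = col_pos_range[OF pl]
  \<comment> \<open>Only the first \<open>d\<close> columns have negative positions, and these are
    the negatives of the positive beads.\<close>
  have pos: "x \<in> maya l \<longleftrightarrow> - x \<notin> maya l" if "x > 0" for x
  proof -
    have "- x \<notin> maya l \<longleftrightarrow> (\<exists>c\<ge>1. - x = col_pos l c)"
      using range by (auto simp: image_iff set_eq_iff)
    also have "\<dots> \<longleftrightarrow> (\<exists>c\<ge>1. c \<le> d \<and> - x = col_pos l c)"
      using d(4) that by (metis less_asym neg_less_0_iff_less not_le)
    also have "\<dots> \<longleftrightarrow> x \<in> pos_beads l"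
      unfolding beads using d(3) by (auto simp: image_iff)
    also have "\<dots> \<longleftrightarrow> x \<in> maya l" using that by (simp add: pos_beads_def)
    finally show ?thesis by simp
  qed
  show "x \<noteq> 0 \<Longrightarrow> x \<in> maya l \<longleftrightarrow> - x \<notin> maya l"
    using pos[of x] pos[of "- x"] by (cases "x > 0") auto
  have row_less: "row_pos l i < row_pos l j \<longleftrightarrow> j < i" if "i \<ge> 1" "j \<ge> 1" for i j
    using row_pos_less_iff[OF pl] that by blast
  have box: "c \<le> part l r \<longleftrightarrow> col_pos l c < row_pos l r" if "r \<ge> 1" "c \<ge> 1" for r c
    using box_iff_pos[OF pl that] by simp
  have colmem: "col_pos l c \<notin> maya l" if "c \<ge> 1" for c using range that by blast
  have rowmem: "row_pos l r \<in> maya l" if "r \<ge> 1" for r using that by (auto simp: maya_def)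
  have ri: "row_pos l r = row_pos l r' \<longleftrightarrow> r = r'" if "r \<ge> 1" "r' \<ge> 1" for r r'
    using inj_row_pos[OF pl] that by (auto simp: inj_on_def)
  have ci: "col_pos l r = col_pos l r' \<longleftrightarrow> r = r'" if "r \<ge> 1" "r' \<ge> 1" for r r'
    using inj_col_pos[OF pl] that by (auto simp: inj_on_def)
  show "bij_betw (\<lambda>(r, c). (row_pos l r, - col_pos l c)) {s \<in> boxes l. diag_sign s = 1}
           (Sigma (pos_beads l) (\<lambda>p. {x \<in> {- p<..p}. - x \<notin> maya l}))" (is "bij_betw ?f ?A ?B")
    unfolding bij_betw_def
  proof
    show "inj_on ?f ?A"
      by (rule inj_onI) (auto simp: boxes_iff ri ci)
    show "?f ` ?A = ?B"
    proof
      show "?f ` ?A \<subseteq> ?B"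
      proof (rule image_subsetI)
        fix s assume "s \<in> ?A"
        then obtain r c where s: "s = (r, c)" "(r, c) \<in> boxes l" "diag_sign (r, c) = 1"
          by (cases s) auto
        then have rc: "r \<ge> 1" "c \<ge> 1" "r \<le> c" "col_pos l c < row_pos l r"
          by (auto simp: boxes_iff box diag_sign_eq split: if_splits)
        have rd: "r \<le> d"
        proof (rule ccontr)
          assume "\<not> r \<le> d"
          then show False using rc d(4)[of c] row_pos_iff[of r] by auto
        qed
        have "- col_pos l c \<le> row_pos l r"
        proof (cases "c \<le> d")
          case True
          then show ?thesis using d(3)[of c] rc row_less[of r c] ri[of r c] by force
        next
          case False
          then show ?thesis using d(4)[of c] d(1)[OF rc(1) rd] by simp
        qed
        then show "?f s \<in> ?B"
          using s(1) rc rd beads colmem by auto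
      qed
      show "?B \<subseteq> ?f ` ?A"
      proof
        fix y assume "y \<in> ?B"
        then obtain p x where y: "y = (p, x)" and p: "p \<in> pos_beads l"
            and x: "x \<in> {- p<..p}" "- x \<notin> maya l"
          by auto
        obtain r where r: "p = row_pos l r" "1 \<le> r" "r \<le> d" using p beads by auto
        obtain c where c: "- x = col_pos l c" "c \<ge> 1" using x range by (metis ComplI atLeast_iff imageE)
        have "r \<le> c"
        proof (rule ccontr)
          assume "\<not> r \<le> c"
          then have "col_pos l c = - row_pos l c" "row_pos l r < row_pos l c"
            using d(3)[of c] c r row_less[of r c] by auto
          then show False using x c r by simp
        qed
        then show "y \<in> ?f ` ?A"
          unfolding y using r c x by (intro image_eqI[of _ _ "(r, c)"]) (auto simp: boxes_iff box diag_sign_eq)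
      qed
    qed
  qed
  show "bij_betw (\<lambda>(r, c). (- col_pos l c, row_pos l r)) {s \<in> boxes l. diag_sign s \<noteq> 1}
           (Sigma (pos_beads l) (\<lambda>p. {x \<in> {- p<..<p}. x \<in> maya l}))" (is "bij_betw ?f ?A ?B")
    unfolding bij_betw_def
  proof
    show "inj_on ?f ?A"
      by (rule inj_onI) (auto simp: boxes_iff ri ci)
    show "?f ` ?A = ?B"
    proof
      show "?f ` ?A \<subseteq> ?B"
      proof (rule image_subsetI)
        fix s assume "s \<in> ?A"
        then obtain r c where s: "s = (r, c)" "(r, c) \<in> boxes l" "diag_sign (r, c) \<noteq> 1"
          by (cases s) auto
        then have rc: "r \<ge> 1" "c \<ge> 1" "c < r" "col_pos l c < row_pos l r"
          by (auto simp: boxes_iff box diag_sign_eq split: if_splits)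
        have cd: "c \<le> d"
        proof (rule ccontr)
          assume "\<not> c \<le> d"
          then show False using rc d(4)[of c] row_pos_iff[of r] by auto
        qed
        then show "?f s \<in> ?B"
          using s(1) rc beads rowmem d(3)[of c] row_less[of r c] by auto
      qed
      show "?B \<subseteq> ?f ` ?A"
      proof
        fix y assume "y \<in> ?B"
        then obtain p x where y: "y = (p, x)" and p: "p \<in> pos_beads l"
            and x: "x \<in> {- p<..<p}" "x \<in> maya l"
          by auto
        obtain c where c: "p = row_pos l c" "1 \<le> c" "c \<le> d" using p beads by auto
        obtain r where r: "x = row_pos l r" "r \<ge> 1" using x by (auto simp: maya_def)
        have "c < r" using x c r row_less[of r c] by auto
        then show "y \<in> ?f ` ?A"
          unfolding y using r c x d(3)[of c] by (intro image_eqI[of _ _ "(r, c)"]) (auto simp: boxes_iff box diag_sign_eq)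
      qed
    qed
  qed
qed

subsection \<open>The hook product as a product over beads\<close>

text \<open>For a bead \<open>p\<close>, the boxes \<open>(i, j)\<close> of sign \<open>1\<close> with \<open>j = p\<close> have \<open>- i\<close> in \<open>arm_set U p\<close> or \<open>- i = p\<close>;
  those of sign \<open>- 1\<close> with \<open>i = - p\<close> have \<open>j\<close> in \<open>arm_set U p\<close> or \<open>j = 0\<close>.\<close>

definition arm_set :: "int set \<Rightarrow> int \<Rightarrow> int set" where
  "arm_set U p = (U \<inter> {1..<p}) \<union> uminus ` ({1..<p} - U)"

lemma finite_arm_set [simp]: "finite (arm_set U p)"
  by (simp add: arm_set_def)

lemma prod_arm_set: "(\<Prod>x\<in>arm_set U p. f x) = (\<Prod>q\<in>{1..<p} - U. f (- q)) * (\<Prod>q\<in>U \<inter> {1..<p}. f q)"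
proof -
  have "(U \<inter> {1..<p}) \<inter> uminus ` ({1..<p} - U) = {}" by auto
  then have "(\<Prod>x\<in>arm_set U p. f x) = (\<Prod>q\<in>U \<inter> {1..<p}. f q) * (\<Prod>q\<in>uminus ` ({1..<p} - U). f q)"
    unfolding arm_set_def by (intro prod.union_disjoint) auto
  also have "(\<Prod>q\<in>uminus ` ({1..<p} - U). f q) = (\<Prod>q\<in>{1..<p} - U. f (- q))"
    by (subst prod.reindex) auto
  finally show ?thesis by (simp add: mult.commute)
qed

text \<open>Exactly one of \<open>q\<close> and \<open>- q\<close> is chosen for each
  \<open>q\<close> in \<open>{1..<p}\<close>.\<close>

lemma card_arm_set:
  assumes "p \<ge> 1"
  shows "card (arm_set U p) = nat (p - 1)"
proof -
  have "(U \<inter> {1..<p}) \<inter> uminus ` ({1..<p} - U) = {}" by auto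
  then have "card (arm_set U p) = card (U \<inter> {1..<p}) + card (uminus ` ({1..<p} - U))"
    unfolding arm_set_def by (intro card_Un_disjoint) auto
  also have "\<dots> = card ((U \<inter> {1..<p}) \<union> ({1..<p} - U))"
    by (subst card_image) (auto intro!: card_Un_disjoint[symmetric])
  also have "(U \<inter> {1..<p}) \<union> ({1..<p} - U) = {1..<p}" by auto
  finally show ?thesis by simp
qed

lemma not_in_arm_set: "p \<notin> arm_set U p" "0 \<notin> arm_set U p"
  by (auto simp: arm_set_def)

context
  fixes l :: "nat list"
  assumes DD': "l \<in> DD'"
begin

lemma finite_ranges:
  fixes p :: int
  shows "finite {x \<in> {- p<..p}. Q x}" "finite {x \<in> {- p<..<p}. Q x}"
  by (rule finite_subset[of _ "{- p<..p}"]; force)+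

text \<open>For \<open>x \<noteq> 0\<close> the symmetry replaces \<open>- x \<notin> maya l\<close>
  by \<open>x \<in> maya l\<close>; 0 is excluded as a bead, while \<open>x = p\<close> is allowed
  and gives the hook length \<open>2 * p\<close>.\<close>

lemma upper_columns:
  assumes "p \<in> pos_beads l"
  shows "{x \<in> {- p<..p}. - x \<notin> maya l} = insert p (arm_set (pos_beads l) p)" (is "?L = ?R")
proof (rule set_eqI)
  fix x :: int
  note m = maya_DD'(1)[OF DD'] maya_DD'(2)[OF DD', of x]
  consider "x = 0" | "x > 0" | "x < 0" by linarith
  then show "x \<in> ?L \<longleftrightarrow> x \<in> ?R"
    using m assms by cases (auto simp: arm_set_def pos_beads_def image_iff intro!: bexI[of _ "- x"])
qed

lemma lower_rows:
  assumes "p \<in> pos_beads l"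
  shows "{x \<in> {- p<..<p}. x \<in> maya l} = insert 0 (arm_set (pos_beads l) p)" (is "?L = ?R")
proof (rule set_eqI)
  fix x :: int
  note m = maya_DD'(1)[OF DD'] maya_DD'(2)[OF DD', of x]
  consider "x = 0" | "x > 0" | "x < 0" by linarith
  then show "x \<in> ?L \<longleftrightarrow> x \<in> ?R"
    using m assms by cases (auto simp: arm_set_def pos_beads_def image_iff intro!: bexI[of _ "- x"])
qed

lemma prod_upper_boxes:
  "(\<Prod>s\<in>{s \<in> boxes l. diag_sign s = 1}. f (hook_length l s)) =
   (\<Prod>p\<in>pos_beads l. f (2 * p) * (\<Prod>x\<in>arm_set (pos_beads l) p. f (p + x)))"
proof -
  have "(\<Prod>s\<in>{s \<in> boxes l. diag_sign s = 1}. f (hook_length l s)) =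
     (\<Prod>(p, x)\<in>Sigma (pos_beads l) (\<lambda>p. {x \<in> {- p<..p}. - x \<notin> maya l}). f (p + x))"
    unfolding prod.reindex_bij_betw[OF maya_DD'(4)[OF DD'], symmetric]
    by (intro prod.cong refl) (auto simp: hook_length_pos)
  also have "\<dots> = (\<Prod>p\<in>pos_beads l. \<Prod>x\<in>{x \<in> {- p<..p}. - x \<notin> maya l}. f (p + x))"
    by (rule prod.Sigma[OF maya_DD'(3)[OF DD'], symmetric]) (intro ballI finite_ranges)
  also have "\<dots> = (\<Prod>p\<in>pos_beads l. f (2 * p) * (\<Prod>x\<in>arm_set (pos_beads l) p. f (p + x)))"
    by (intro prod.cong refl) (simp only: upper_columns prod.insert finite_arm_set not_in_arm_set mult_2 add_0_right not_False_eq_True)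
  finally show ?thesis .
qed

lemma prod_lower_boxes:
  "(\<Prod>s\<in>{s \<in> boxes l. diag_sign s \<noteq> 1}. f (hook_length l s)) =
   (\<Prod>p\<in>pos_beads l. f p * (\<Prod>x\<in>arm_set (pos_beads l) p. f (p + x)))"
proof -
  have "(\<Prod>s\<in>{s \<in> boxes l. diag_sign s \<noteq> 1}. f (hook_length l s)) =
     (\<Prod>(p, x)\<in>Sigma (pos_beads l) (\<lambda>p. {x \<in> {- p<..<p}. x \<in> maya l}). f (p + x))"
    unfolding prod.reindex_bij_betw[OF maya_DD'(5)[OF DD'], symmetric]
    by (intro prod.cong refl) (auto simp: hook_length_pos)
  also have "\<dots> = (\<Prod>p\<in>pos_beads l. \<Prod>x\<in>{x \<in> {- p<..<p}. x \<in> maya l}. f (p + x))"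
    by (rule prod.Sigma[OF maya_DD'(3)[OF DD'], symmetric]) (intro ballI finite_ranges)
  also have "\<dots> = (\<Prod>p\<in>pos_beads l. f p * (\<Prod>x\<in>arm_set (pos_beads l) p. f (p + x)))"
    by (intro prod.cong refl) (simp only: lower_rows prod.insert finite_arm_set not_in_arm_set mult_2 add_0_right not_False_eq_True)
  finally show ?thesis .
qed

lemma pos_beads_ge1: "p \<in> pos_beads l \<Longrightarrow> p \<ge> 1"
  by (auto simp: pos_beads_def)

lemma boxes_split:
  "boxes l = {s \<in> boxes l. diag_sign s = 1} \<union> {s \<in> boxes l. diag_sign s \<noteq> 1}"
  by auto

text \<open>Each bead \<open>p\<close> accounts for \<open>p\<close> boxes of either sign: its arm
  set and one extra box.\<close>

lemma int_sum_list: "int (sum_list l) = (\<Sum>p\<in>pos_beads l. 2 * p)"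
proof -
  note fin = maya_DD'(3)[OF DD']
  have "card (boxes l) = card {s \<in> boxes l. diag_sign s = 1} + card {s \<in> boxes l. diag_sign s \<noteq> 1}"
    using finite_boxes by (subst boxes_split, intro card_Un_disjoint) auto
  also have "card {s \<in> boxes l. diag_sign s = 1} = (\<Sum>p\<in>pos_beads l. nat p)"
  proof -
    have "card {s \<in> boxes l. diag_sign s = 1} =
        (\<Sum>p\<in>pos_beads l. card {x \<in> {- p<..p}. - x \<notin> maya l})"
      unfolding bij_betw_same_card[OF maya_DD'(4)[OF DD']]
      by (rule card_SigmaI[OF fin]) (intro ballI finite_ranges)
    also have "\<dots> = (\<Sum>p\<in>pos_beads l. nat p)"
    proof (intro sum.cong refl)
      fix p assume p: "p \<in> pos_beads l"
      then show "card {x \<in> {- p<..p}. - x \<notin> maya l} = nat p"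
        unfolding upper_columns[OF p] using pos_beads_ge1[OF p] by (simp add: not_in_arm_set card_arm_set)
    qed
    finally show ?thesis .
  qed
  also have "card {s \<in> boxes l. diag_sign s \<noteq> 1} = (\<Sum>p\<in>pos_beads l. nat p)"
  proof -
    have "card {s \<in> boxes l. diag_sign s \<noteq> 1} =
        (\<Sum>p\<in>pos_beads l. card {x \<in> {- p<..<p}. x \<in> maya l})"
      unfolding bij_betw_same_card[OF maya_DD'(5)[OF DD']]
      by (rule card_SigmaI[OF fin]) (intro ballI finite_ranges)
    also have "\<dots> = (\<Sum>p\<in>pos_beads l. nat p)"
    proof (intro sum.cong refl)
      fix p assume p: "p \<in> pos_beads l"
      then show "card {x \<in> {- p<..<p}. x \<in> maya l} = nat p"
        unfolding lower_rows[OF p] using pos_beads_ge1[OF p] by (simp add: not_in_arm_set card_arm_set)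
    qed
    finally show ?thesis .
  qed
  finally have "int (sum_list l) = (\<Sum>p\<in>pos_beads l. int (nat p)) + (\<Sum>p\<in>pos_beads l. int (nat p))"
    unfolding sum_list_eq_card_boxes by simp
  also have "\<dots> = (\<Sum>p\<in>pos_beads l. 2 * p)"
    unfolding sum.distrib[symmetric] by (intro sum.cong) (auto dest: pos_beads_ge1)
  finally show ?thesis .
qed

lemma hook_length_ge1:
  assumes "s \<in> boxes l"
  shows "hook_length l s \<ge> 1"
proof -
  obtain r c where s: "s = (r, c)" by (cases s)
  have "is_partition l" using DD'_structure[OF DD'] by blast
  then show ?thesis
    using assms box_iff_pos(1)[of l r c] by (simp add: s boxes_iff hook_length_pos)
qed

lemma prod_hook_count:
  fixes f :: "int \<Rightarrow> 'a::comm_monoid_mult"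
  shows "(\<Prod>s\<in>{s \<in> boxes l. diag_sign s = 1 \<and> hook_length l s < int g}. f (int g - hook_length l s)) =
     (\<Prod>i=1..g - 1. f (int i) ^ hook_count g l i)"
proof -
  let ?S = "{s \<in> boxes l. diag_sign s = 1 \<and> hook_length l s < int g}"
  let ?k = "\<lambda>s. nat (int g - hook_length l s)"
  have fin: "finite ?S" using finite_boxes by simp
  have sub: "?k ` ?S \<subseteq> {1..g - 1}"
    using hook_length_ge1 by (force simp: nat_le_iff)
  have "(\<Prod>s\<in>?S. f (int g - hook_length l s)) = (\<Prod>i=1..g - 1. \<Prod>s\<in>{s \<in> ?S. ?k s = i}. f (int g - hook_length l s))"
    by (rule prod.group[symmetric, OF fin _ sub]) simp
  also have "\<dots> = (\<Prod>i=1..g - 1. \<Prod>s\<in>{s \<in> boxes l. hook_length l s = int g - int i \<and> diag_sign s = 1}. f (int i))"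
    by (intro prod.cong) auto
  finally show ?thesis by (simp add: hook_count_def)
qed

text \<open>The arm set of a bead gives the same hook lengths with both signs, and each such pair
  yields one \<open>T\<close>. The unpaired hook lengths \<open>2 * p\<close> and \<open>p\<close>
  yield the prefactors of \<open>bead_weight\<close>.\<close>

lemma hook_prod_eq_bead_prod:
  fixes \<tau> :: "int \<Rightarrow> 'a::field"
  assumes nz: "\<And>k. \<tau> k \<noteq> 0" and "g \<ge> 1"
  defines "\<sigma> \<equiv> (\<lambda>k. \<tau> \<bar>k\<bar>)"
  shows "(\<Prod>s\<in>boxes l. \<tau> (hook_length l s - diag_sign s * int g) / \<tau> (hook_length l s)) =
     (\<Prod>i=1..g - 1. (\<tau> (- int i) / \<tau> (int i)) ^ hook_count g l i) *
     even_weight.bead_prod \<sigma> (int g) (pos_beads l)"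
proof -
  interpret even_weight \<sigma> "int g"
    using assms by unfold_locales (auto simp: \<sigma>_def)
  let ?U = "pos_beads l"
  let ?P = "{s \<in> boxes l. diag_sign s = 1}" and ?M = "{s \<in> boxes l. diag_sign s \<noteq> 1}"
  let ?h = "hook_length l"
  \<comment> \<open>The correction from \<open>\<sigma>\<close> to \<open>\<tau>\<close>: only a box
    of sign 1 with hook length below \<open>g\<close> has a negative argument.\<close>
  let ?\<kappa> = "\<lambda>h. if h < int g then \<tau> (h - int g) / \<tau> (int g - h) else 1"
  have fin: "finite ?P" "finite ?M" using finite_boxes by auto
  have "(\<Prod>s\<in>boxes l. \<tau> (?h s - diag_sign s * int g) / \<tau> (?h s)) =
     (\<Prod>s\<in>?P. \<tau> (?h s - diag_sign s * int g) / \<tau> (?h s)) *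
     (\<Prod>s\<in>?M. \<tau> (?h s - diag_sign s * int g) / \<tau> (?h s))"
    using fin by (subst boxes_split, intro prod.union_disjoint) auto
  also have "(\<Prod>s\<in>?M. \<tau> (?h s - diag_sign s * int g) / \<tau> (?h s)) = (\<Prod>s\<in>?M. G (?h s))"
    using hook_length_ge1 by (intro prod.cong refl) (force simp: ratio_def \<sigma>_def diag_sign_def split: prod.splits if_splits)
  also have "(\<Prod>s\<in>?P. \<tau> (?h s - diag_sign s * int g) / \<tau> (?h s)) =
      (\<Prod>s\<in>?P. ?\<kappa> (?h s) * (\<sigma> (?h s - int g) / \<sigma> (?h s)))"
    using hook_length_ge1 nz by (intro prod.cong refl) (force simp: \<sigma>_def)
  also have "\<dots> = (\<Prod>s\<in>?P. ?\<kappa> (?h s)) * (\<Prod>s\<in>?P. \<sigma> (?h s - int g) / \<sigma> (?h s))"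
    by (rule prod.distrib)
  also have "(\<Prod>s\<in>?P. ?\<kappa> (?h s)) = (\<Prod>s\<in>{s \<in> boxes l. diag_sign s = 1 \<and> ?h s < int g}. \<tau> (- (int g - ?h s)) / \<tau> (int g - ?h s))"
    using fin by (intro prod.mono_neutral_cong_right) auto
  also have "\<dots> = (\<Prod>i=1..g - 1. (\<tau> (- int i) / \<tau> (int i)) ^ hook_count g l i)"
    by (rule prod_hook_count)
  also have "(\<Prod>s\<in>?P. \<sigma> (?h s - int g) / \<sigma> (?h s)) =
      (\<Prod>p\<in>?U. \<sigma> (2 * p - int g) / \<sigma> (2 * p) * (\<Prod>x\<in>arm_set ?U p. \<sigma> (p + x - int g) / \<sigma> (p + x)))"
    by (rule prod_upper_boxes)
  also have "(\<Prod>s\<in>?M. G (?h s)) = (\<Prod>p\<in>?U. G p * (\<Prod>x\<in>arm_set ?U p. G (p + x)))"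
    by (rule prod_lower_boxes)
  finally have "(\<Prod>s\<in>boxes l. \<tau> (?h s - diag_sign s * int g) / \<tau> (?h s)) =
     (\<Prod>i=1..g - 1. (\<tau> (- int i) / \<tau> (int i)) ^ hook_count g l i) *
     ((\<Prod>p\<in>?U. \<sigma> (2 * p - int g) / \<sigma> (2 * p) * (\<Prod>x\<in>arm_set ?U p. \<sigma> (p + x - int g) / \<sigma> (p + x))) *
     (\<Prod>p\<in>?U. G p * (\<Prod>x\<in>arm_set ?U p. G (p + x))))"
    by (simp only: mult.assoc)
  also have "(\<Prod>p\<in>?U. \<sigma> (2 * p - int g) / \<sigma> (2 * p) * (\<Prod>x\<in>arm_set ?U p. \<sigma> (p + x - int g) / \<sigma> (p + x))) *
     (\<Prod>p\<in>?U. G p * (\<Prod>x\<in>arm_set ?U p. G (p + x))) = bead_prod ?U"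
    unfolding bead_prod_def prod.distrib[symmetric]
  proof (intro prod.cong refl)
    fix p
    have "(\<Prod>x\<in>arm_set ?U p. \<sigma> (p + x - int g) / \<sigma> (p + x)) * (\<Prod>x\<in>arm_set ?U p. G (p + x)) =
       (\<Prod>x\<in>arm_set ?U p. T (p + x))"
      unfolding prod.distrib[symmetric]
      by (intro prod.cong refl) (simp add: ratio2_def ratio_def)
    also have "\<dots> = (\<Prod>q\<in>{1..<p} - ?U \<inter> {1..<p}. T (p - q)) * (\<Prod>q\<in>?U \<inter> {1..<p}. T (p + q))"
      unfolding prod_arm_set by (simp add: Diff_Int)
    finally show "\<sigma> (2 * p - int g) / \<sigma> (2 * p) * (\<Prod>x\<in>arm_set ?U p. \<sigma> (p + x - int g) / \<sigma> (p + x)) *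
       (G p * (\<Prod>x\<in>arm_set ?U p. G (p + x))) = bead_weight p (?U \<inter> {1..<p})"
      unfolding bead_weight_def by (simp only: mult_ac)
  qed
  finally show ?thesis .
qed

end

subsection \<open>Quotient and coding\<close>

lemma word_Nil: "word [] k = 0 \<longleftrightarrow> k < 0"
proof -
  have "(\<exists>i\<ge>1::nat. k = - int i) \<longleftrightarrow> k < 0"
    by (auto intro!: exI[of _ "nat (- k)"])
  then show ?thesis by (auto simp: word_def part_def)
qed

lemma word_rectangle:
  assumes "m \<ge> 1"
  shows "word (rectangle m (m - 1)) k = 0 \<longleftrightarrow> (- 1 \<le> k \<and> k < int m - 1) \<or> k < - int m"
proof -
  have part: "part (rectangle m (m - 1)) i = (if 1 \<le> i \<and> i \<le> m then m - 1 else 0)" for i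
    using assms by (auto simp: part_def rectangle_def)
  have "(\<exists>i\<ge>1. k = int (if 1 \<le> i \<and> i \<le> m then m - 1 else 0) - int i) \<longleftrightarrow>
      (- 1 \<le> k \<and> k < int m - 1) \<or> k < - int m" (is "?L \<longleftrightarrow> ?R")
  proof
    assume ?R
    then show ?L
    proof
      assume "- 1 \<le> k \<and> k < int m - 1"
      then show ?L using assms by (intro exI[of _ "nat (int m - 1 - k)"]) auto
    next
      assume "k < - int m"
      then show ?L using assms by (intro exI[of _ "nat (- k)"]) auto
    qed
  next
    assume ?L
    then obtain i where i: "i \<ge> 1" "k = int (if 1 \<le> i \<and> i \<le> m then m - 1 else 0) - int i" by blast
    show ?R
    proof (cases "i \<le> m")
      case True
      then have "k = int m - 1 - int i" using i assms by (simp add: of_nat_diff)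
      then show ?thesis using i(1) True by simp
    next
      case False
      then show ?thesis using i by simp
    qed
  qed
  then show ?thesis unfolding word_def part by presburger
qed

text \<open>The shift in \<open>maya\<close> moves the subword \<open>c - 1\<close> to the residue
  \<open>c\<close>, so the rectangle sits on the multiples of \<open>g\<close>. An empty component
  makes the beads of its residue an initial segment; for the multiples of \<open>g\<close> this is
  claimed only from \<open>int g\<close> upwards, since a nonempty rectangle leaves gaps below
  0.\<close>

lemma DD'1_runners:
  assumes "l \<in> DD'1 t" "t \<ge> 1" "g = 2 * t - 1"
  obtains \<delta> :: "int \<Rightarrow> int" where
    "\<And>c k. 1 \<le> c \<Longrightarrow> c < int g \<Longrightarrow> c + int g * k \<in> maya l \<longleftrightarrow> k < \<delta> c"
    "\<delta> (int g) \<ge> 0" "\<And>k. k \<ge> 0 \<Longrightarrow> int g + int g * k \<in> maya l \<longleftrightarrow> k < \<delta> (int g)"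
proof -
  obtain \<nu> m where l: "l \<in> DD'" and q: "is_quotient g l \<nu>"
    and empty: "\<And>k. k < g \<Longrightarrow> k \<noteq> g - 1 \<Longrightarrow> \<nu> k = []"
    and rect: "\<nu> (g - 1) = rectangle m (m - 1)" and m: "m \<ge> 1"
  proof -
    have "2 * t - 2 = g - 1" using assms by simp
    then show ?thesis using assms(1) that unfolding DD'1_def assms(3)[symmetric] by auto
  qed
  have g: "g \<ge> 1" using assms by simp
  have "\<exists>d::int. \<forall>i::int. word (\<nu> (nat (c - 1))) i = word l (int g * (i + d) + int (nat (c - 1)))"
    if "1 \<le> c" "c \<le> int g" for c
  proof -
    have "nat (c - 1) < g" using that by auto
    then show ?thesis using q unfolding is_quotient_def by blast
  qed
  then obtain d :: "int \<Rightarrow> int" where d: "\<And>c i. 1 \<le> c \<Longrightarrow> c \<le> int g \<Longrightarrow>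
      word (\<nu> (nat (c - 1))) i = word l (int g * (i + d c) + int (nat (c - 1)))"
    by metis
  have mem: "c + int g * k \<in> maya l \<longleftrightarrow> word (\<nu> (nat (c - 1))) (k - d c) = 0"
    if "1 \<le> c" "c \<le> int g" for c k
    using d[OF that, of "k - d c"] that by (simp add: maya_word algebra_simps)
  let ?d = "d (int g)"
  have multiples: "int g * k \<in> maya l \<longleftrightarrow> ?d \<le> k \<and> k < int m + ?d \<or> k \<le> ?d - int m" for k
  proof -
    have "nat (int g - 1) = g - 1" using g by auto
    then have "int g * k \<in> maya l \<longleftrightarrow> word (rectangle m (m - 1)) (k - 1 - ?d) = 0"
      using mem[of "int g" "k - 1"] g rect by (simp add: algebra_simps)
    then show ?thesis unfolding word_rectangle[OF m] by auto
  qed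
  have sym: "int g * k \<in> maya l \<longleftrightarrow> int g * (- k) \<notin> maya l" if "k \<noteq> 0" for k
    using maya_DD'(2)[OF l, of "int g * k"] that g by simp
  have "int g * 0 \<in> maya l" using maya_DD'(1)[OF l] by simp
  note d0 = this[unfolded multiples]
  \<comment> \<open>the largest multiple of \<open>g\<close> in the bead set determines its reflection, so the quotient is not shifted\<close>
  have "?d = 0"
  proof (rule ccontr)
    assume "?d \<noteq> 0"
    then consider "?d > 0" | "?d < 0" by linarith
    then show False
    proof cases
      case 1
      then show False
        using sym[of "int m - 1 + ?d"] m unfolding multiples by auto
    next
      case 2
      then show False
        using sym[of "int m - 1 - ?d"] m d0 unfolding multiples by auto
    qed
  qed
  note multiples = multiples[unfolded this]
  define \<delta> where "\<delta> c = (if c = int g then int m - 1 else d c)" for c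
  show ?thesis
  proof (rule that[of \<delta>])
    fix c k assume c: "1 \<le> c" "c < int g"
    then have "\<nu> (nat (c - 1)) = []" by (intro empty) auto
    then show "c + int g * k \<in> maya l \<longleftrightarrow> k < \<delta> c"
      using mem[of c k] c by (simp add: word_Nil \<delta>_def)
  next
    show "\<delta> (int g) \<ge> 0" using m by (simp add: \<delta>_def)
  next
    \<comment> \<open>The \<open>m\<close> nonnegative multiples of \<open>g\<close> in the bead set
      include 0, so \<open>m - 1\<close> of them remain for the chain starting at
      \<open>int g\<close>.\<close>
    fix k :: int assume "k \<ge> 0"
    then show "int g + int g * k \<in> maya l \<longleftrightarrow> k < \<delta> (int g)"
      using multiples[of "k + 1"] m by (auto simp: \<delta>_def algebra_simps)
  qed
qed

lemma coding_beta_eq: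
  assumes "1 \<le> c" "c \<le> int g" and mem: "c + int g * (d - 1) \<in> maya l"
    and notin: "\<And>k. k \<ge> d \<Longrightarrow> c + int g * k \<notin> maya l"
  shows "coding_beta g l (nat (c - 1)) = c + int g * d - 1"
  unfolding coding_beta_def
proof (rule Greatest_equality)
  have w: "word l (k * int g + int (nat (c - 1))) = 0 \<longleftrightarrow> c + int g * k \<in> maya l" for k
    using assms(1,2) by (simp add: maya_word algebra_simps)
  show "\<exists>k. c + int g * d - 1 = (k + 1) * int g + int (nat (c - 1)) \<and> word l (k * int g + int (nat (c - 1))) = 0"
    unfolding w using mem assms(1) by (intro exI[of _ "d - 1"]) (simp add: algebra_simps)
  fix y assume "\<exists>k. y = (k + 1) * int g + int (nat (c - 1)) \<and> word l (k * int g + int (nat (c - 1))) = 0"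
  then obtain k where k: "y = (k + 1) * int g + int (nat (c - 1))" "k < d"
    unfolding w using notin by (metis not_le)
  have "(k + 1) * int g \<le> d * int g" using k(2) by (intro mult_right_mono) auto
  then show "y \<le> c + int g * d - 1" using k assms(1) by (simp add: algebra_simps)
qed

lemma take_rev_sorted_list_of_set:
  fixes B :: "'a::linorder set"
  assumes "finite B" "W \<subseteq> B" and up: "\<And>x y. x \<in> W \<Longrightarrow> y \<in> B - W \<Longrightarrow> y < x"
  shows "take (card W) (rev (sorted_list_of_set B)) = rev (sorted_list_of_set W)"
proof -
  have fin: "finite W" "finite (B - W)" using assms finite_subset by auto
  have "sorted_list_of_set (B - W) @ sorted_list_of_set W = sorted_list_of_set B"
  proof (rule sorted_distinct_set_unique)
    show "sorted (sorted_list_of_set (B - W) @ sorted_list_of_set W)"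
      using fin up by (auto simp: sorted_append intro: less_imp_le)
  qed (use fin assms in auto)
  then have "rev (sorted_list_of_set B) = rev (sorted_list_of_set W) @ rev (sorted_list_of_set (B - W))"
    by (metis rev_append)
  then show ?thesis using fin by simp
qed

text \<open>The runner ends \<open>b c\<close> satisfy \<open>b (g - c) = g - b c\<close>, so
  exactly one end of each pair exceeds \<open>g / 2\<close>. The ends above this threshold are the
  \<open>t\<close> largest, and their residues form the half system.\<close>

lemma DD'1_coding:
  assumes "l \<in> DD'1 t" "t \<ge> 1" "g = 2 * t - 1"
  obtains C n where "half_system (int g) C" "pos_beads l = bead_chains (int g) C n"
    "\<And>c. c \<in> C \<Longrightarrow> 2 * (c + int g * int (n c)) > int g"
    "inj_on (\<lambda>c. c + int g * int (n c) - 1) C"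
    "V_coding g t l = rev (sorted_list_of_set ((\<lambda>c. c + int g * int (n c) - 1) ` C))" "card C = t"
proof -
  have l: "l \<in> DD'" using assms(1) by (simp add: DD'1_def)
  have g: "g \<ge> 1" "int g = 2 * int t - 1" using assms by auto
  obtain \<delta> :: "int \<Rightarrow> int" where
    run: "\<And>c k. 1 \<le> c \<Longrightarrow> c < int g \<Longrightarrow> c + int g * k \<in> maya l \<longleftrightarrow> k < \<delta> c" and
    \<delta>g: "\<delta> (int g) \<ge> 0" and rung: "\<And>k. k \<ge> 0 \<Longrightarrow> int g + int g * k \<in> maya l \<longleftrightarrow> k < \<delta> (int g)"
    using DD'1_runners[OF assms] by blast
  define b where "b c = c + int g * \<delta> c" for c
  \<comment> \<open>Negation maps the runner \<open>c\<close> to the runner \<open>g - c\<close> and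
    exchanges beads with gaps.\<close>
  have flip: "\<delta> (int g - c) = - \<delta> c" if c: "1 \<le> c" "c < int g" for c
  proof -
    have "k < \<delta> c \<longleftrightarrow> k < - \<delta> (int g - c)" for k
    proof -
      have "c + int g * k \<noteq> 0"
      proof
        assume "c + int g * k = 0"
        then have "int g dvd c" by (metis dvd_add_left_iff dvd_0_right dvd_triv_left)
        then show False using zdvd_imp_le[of "int g" c] c by simp
      qed
      from maya_DD'(2)[OF l this]
      have "c + int g * k \<in> maya l \<longleftrightarrow> (int g - c) + int g * (- k - 1) \<notin> maya l"
        by (simp add: algebra_simps)
      then show ?thesis using run[of c k] run[of "int g - c" "- k - 1"] c by auto
    qed
    from this[of "\<delta> c"] this[of "\<delta> c - 1"] show ?thesis by linarith
  qed
  have beta: "coding_beta g l (nat (c - 1)) = b c - 1" if c: "1 \<le> c" "c \<le> int g" for c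
  proof (cases "c = int g")
    case False
    then show ?thesis unfolding b_def using c run[of c] by (intro coding_beta_eq) auto
  next
    case True
    \<comment> \<open>If the chain of \<open>g\<close> is empty, the last bead of this runner is 0,
      which always belongs to \<open>maya l\<close>.\<close>
    have "int g + int g * (\<delta> (int g) - 1) \<in> maya l"
      using rung[of "\<delta> (int g) - 1"] \<delta>g maya_DD'(1)[OF l] by (cases "\<delta> (int g) = 0") auto
    then show ?thesis unfolding b_def True using g rung \<delta>g by (intro coding_beta_eq) auto
  qed
  have inj: "inj_on (\<lambda>c. b c - 1) {1..int g}"
    using chain_coord_eq unfolding b_def by (intro inj_onI) (metis diff_add_cancel)
  define C where "C = {c \<in> {1..int g}. 2 * b c > int g}"
  define n where "n c = nat (\<delta> c)" for c
  have small: "\<delta> c \<le> 0" if c: "c \<in> {1..int g}" "c \<notin> C" for c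
  proof (rule ccontr)
    assume "\<not> \<delta> c \<le> 0"
    then have "int g * 1 \<le> int g * \<delta> c" by (intro mult_left_mono) auto
    then show False using c by (auto simp: C_def b_def)
  qed
  have large: "\<delta> c \<ge> 0" if c: "c \<in> C" for c
  proof (rule ccontr)
    assume "\<not> \<delta> c \<ge> 0"
    then have "int g * \<delta> c \<le> int g * (- 1)" by (intro mult_left_mono) auto
    then show False using c by (auto simp: C_def b_def)
  qed
  have bn: "b c = c + int g * int (n c)" if "c \<in> C" for c
    using large[OF that] by (simp add: b_def n_def)
  have hs: "half_system (int g) C"
    unfolding half_system_def
  proof (intro conjI ballI)
    show "C \<subseteq> {1..int g}" by (auto simp: C_def)
    have "int g * \<delta> (int g) \<ge> 0" using \<delta>g by simp
    then show "int g \<in> C" using g(1) by (simp add: C_def b_def)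
    fix c assume c: "c \<in> {1..<int g}"
    then have "b (int g - c) = int g - b c" using flip[of c] by (simp add: b_def algebra_simps)
    \<comment> \<open>Since \<open>g\<close> is odd, no end lies on the threshold.\<close>
    moreover have "2 * b c \<noteq> int g" using g(2) by presburger
    ultimately show "c \<in> C \<longleftrightarrow> int g - c \<notin> C" using c by (auto simp: C_def)
  qed
  have cardC: "card C = t"
    using card_image[OF fold_half_system(1)[OF hs g(2)]] fold_half_system(2)[OF hs g(2)] assms(2,3)
    by simp
  have beads: "pos_beads l = bead_chains (int g) C n"
  proof (rule set_eqI)
    fix x
    show "x \<in> pos_beads l \<longleftrightarrow> x \<in> bead_chains (int g) C n"
    proof
      assume x: "x \<in> pos_beads l"
      \<comment> \<open>Reducing \<open>x - 1\<close> puts the residue into \<open>{1..g}\<close>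
        rather than \<open>{0..<g}\<close>.\<close>
      define c k where "c = (x - 1) mod int g + 1" and "k = (x - 1) div int g"
      have xk: "x = c + int g * k" unfolding c_def k_def by (simp add: algebra_simps)
      have "(x - 1) mod int g < int g" using g(1) by (intro pos_mod_bound) simp
      then have c: "1 \<le> c" "c \<le> int g" "k \<ge> 0"
        using g(1) x zless_imp_add1_zle[of "(x - 1) mod int g" "int g"]
        by (simp_all add: c_def k_def pos_beads_def pos_imp_zdiv_nonneg_iff)
      have k: "k < \<delta> c"
        using x c run[of c k] rung[of k] xk by (cases "c = int g") (auto simp: pos_beads_def)
      then have "c \<in> C" using small[of c] c by force
      then show "x \<in> bead_chains (int g) C n"
        unfolding bead_chains_def using k c xk
        by (intro image_eqI[of _ _ "(c, nat k)"]) (auto simp: n_def)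
    next
      assume x: "x \<in> bead_chains (int g) C n"
      then obtain c k where ck: "c \<in> C" "k < n c" "x = c + int g * int k"
        by (auto simp: bead_chains_def)
      then have "x \<in> maya l"
        using run[of c "int k"] rung[of "int k"] by (cases "c = int g") (auto simp: C_def n_def)
      then show "x \<in> pos_beads l" using bead_chains_pos[OF hs x] by (simp add: pos_beads_def)
    qed
  qed
  note Csub = half_systemD(1)[OF hs]
  let ?W = "(\<lambda>c. b c - 1) ` C"
  have "coding_beta g l ` {0..<g} = (\<lambda>c. coding_beta g l (nat (c - 1))) ` {1..int g}"
  proof -
    have "{0..<g} = (\<lambda>c. nat (c - 1)) ` {1..int g}"
    proof (intro equalityI subsetI)
      fix i assume "i \<in> {0..<g}"
      then show "i \<in> (\<lambda>c. nat (c - 1)) ` {1..int g}"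
        by (intro image_eqI[of _ _ "int i + 1"]) auto
    qed auto
    then show ?thesis by (metis image_image)
  qed
  also have "\<dots> = (\<lambda>c. b c - 1) ` {1..int g}" using beta by (intro image_cong) auto
  finally have B: "coding_beta g l ` {0..<g} = (\<lambda>c. b c - 1) ` {1..int g}" .
  have cardW: "card ?W = t"
    using card_image[OF inj_on_subset[OF inj Csub]] cardC by simp
  have Weq: "?W = (\<lambda>c. c + int g * int (n c) - 1) ` C"
    using bn by (intro image_cong) auto
  have V: "V_coding g t l = rev (sorted_list_of_set ((\<lambda>c. c + int g * int (n c) - 1) ` C))"
    unfolding V_coding_def B Weq[symmetric] cardW[symmetric]
    by (rule take_rev_sorted_list_of_set) (auto simp: C_def)
  have injn: "inj_on (\<lambda>c. c + int g * int (n c) - 1) C"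
    using inj_on_subset[OF inj Csub] bn by (simp add: inj_on_def)
  have big: "2 * (c + int g * int (n c)) > int g" if "c \<in> C" for c
    using bn[OF that] that by (simp add: C_def)
  show ?thesis by (rule that[OF hs beads big injn V cardC])
qed

section \<open>Assembly of the size formula and the product formula\<close>

theorem theorem4p19:
  fixes t g :: nat and l :: "nat list" and v :: "int list" and r :: "nat \<Rightarrow> real"
  assumes "t \<ge> 1" and "g = 2 * t - 1" and "l \<in> DD'1 t"
    and "v = V_coding g t l"
    and "\<And>i. 1 \<le> i \<Longrightarrow> i \<le> t \<Longrightarrow> r i = real_of_int (v ! (i - 1)) - real g / 2 + 1"
  shows "real (sum_list l) =
           1 / real g * (\<Sum>i=1..t. (r i)\<^sup>2)
             - (real g + 2) * (real_of_int \<lfloor>real g / 2\<rfloor> + 1) / 12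
       \<and> (\<forall>\<tau> :: int \<Rightarrow> 'a::field. (\<forall>k. \<tau> k \<noteq> 0) \<longrightarrow>
           (\<Prod>s\<in>boxes l. \<tau> (hook_length l s - diag_sign s * int g) / \<tau> (hook_length l s)) =
           (\<Prod>i=1..g - 1. (\<tau> (- int i) / \<tau> (int i)) ^ hook_count g l i) *
           (\<Prod>(i, j)\<in>{(i, j). 1 \<le> i \<and> i < j \<and> j \<le> t}.
              \<tau> \<lfloor>r i - r j\<rfloor> / \<tau> (int j - int i) *
              (\<tau> \<lfloor>r i + r j\<rfloor> / \<tau> (int g + 2 - int i - int j))))"
proof -
  have l: "l \<in> DD'" using assms(3) by (simp add: DD'1_def)
  have g: "g \<ge> 1" "int g = 2 * int t - 1" "int t \<ge> 1" using assms(1,2) by auto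
  obtain C n where hs: "half_system (int g) C" and beads: "pos_beads l = bead_chains (int g) C n"
    and big: "\<And>c. c \<in> C \<Longrightarrow> 2 * (c + int g * int (n c)) > int g"
    and inj: "inj_on (\<lambda>c. c + int g * int (n c) - 1) C"
    and coding: "V_coding g t l = rev (sorted_list_of_set ((\<lambda>c. c + int g * int (n c) - 1) ` C))"
    and cardC: "card C = t"
    using DD'1_coding[OF assms(3,1,2)] by blast
  note fin = half_system_finite[OF hs]
  define b where "b c = c + int g * int (n c)" for c
  \<comment> \<open>\<open>w i\<close> is the integer \<open>r i + g / 2\<close>, the end of a
    chain; the 1 undoes the shift between word and beads.\<close>
  define w where "w i = v ! (i - 1) + 1" for i
  have v: "v = rev (sorted_list_of_set ((\<lambda>c. b c - 1) ` C))"
    unfolding assms(4) coding b_def ..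
  have inj': "inj_on (\<lambda>c. b c - 1) C" and injb: "inj_on b C"
    using inj by (auto simp: b_def inj_on_def)
  have len: "length v = t" unfolding v using card_image[OF inj'] cardC by simp
  have setv: "set v = (\<lambda>c. b c - 1) ` C" unfolding v using fin by simp
  have decr: "sorted_wrt (>) v"
    unfolding v sorted_wrt_rev using strict_sorted_list_of_set by simp
  have w_less: "w j < w i" if "1 \<le> i" "i < j" "j \<le> t" for i j
  proof -
    have "i - 1 < j - 1" "j - 1 < length v" using that len by auto
    from sorted_wrt_nth_less[OF decr this] show ?thesis by (simp add: w_def)
  qed
  have injw: "inj_on w {1..t}"
    by (rule inj_onI) (metis atLeastAtMost_iff linorder_neqE_nat less_irrefl w_less)
  have w_image: "w ` {1..t} = b ` C"
  proof -
    have "w ` {1..t} = (\<lambda>x. x + 1) ` (\<lambda>i. v ! i) ` {..<t}"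
    proof -
      have "{..<t} = (\<lambda>i. i - 1) ` {1..t}"
      proof (intro equalityI subsetI)
        fix i assume "i \<in> {..<t}"
        then show "i \<in> (\<lambda>i. i - 1) ` {1..t}" by (intro image_eqI[of _ _ "i + 1"]) auto
      qed auto
      then show ?thesis by (simp add: image_image w_def)
    qed
    also have "(\<lambda>i. v ! i) ` {..<t} = set v" unfolding set_conv_nth using len by auto
    finally show ?thesis unfolding setv by (simp add: image_image)
  qed
  \<comment> \<open>This says \<open>r i > 0\<close>, so the sums \<open>r i + r j\<close> are
    positive and \<open>\<sigma>\<close> agrees with \<open>\<tau>\<close> there.\<close>
  have w_big: "2 * w i > int g" if "1 \<le> i" "i \<le> t" for i
  proof -
    have "w i \<in> b ` C" using w_image that by auto
    then show ?thesis using big by (auto simp: b_def)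
  qed
  have r: "r i = real_of_int (w i) - real g / 2" if "1 \<le> i" "i \<le> t" for i
    using assms(5)[OF that] by (simp add: w_def)
  have "real (sum_list l) = real_of_int (\<Sum>p\<in>bead_chains (int g) C n. 2 * p)"
    using arg_cong[OF int_sum_list[OF l], of real_of_int] unfolding beads by simp
  also have "\<dots> = 1 / real g * (\<Sum>c\<in>C. (real_of_int (b c) - real g / 2)\<^sup>2) - (real g + 2) * real t / 12"
    using sum_chains_double[OF hs g(2,3), of n] by (simp add: b_def)
  also have "(\<Sum>c\<in>C. (real_of_int (b c) - real g / 2)\<^sup>2) = (\<Sum>x\<in>b ` C. (real_of_int x - real g / 2)\<^sup>2)"
    using injb by (simp add: sum.reindex)
  also have "\<dots> = (\<Sum>i=1..t. (r i)\<^sup>2)"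
    unfolding w_image[symmetric] sum.reindex[OF injw] using r by (intro sum.cong) auto
  also have "real t = real_of_int \<lfloor>real g / 2\<rfloor> + 1"
  proof -
    have "\<lfloor>real g / 2\<rfloor> = int t - 1"
      using g by (intro floor_unique) (simp_all add: field_simps)
    then show ?thesis by simp
  qed
  finally have size: "real (sum_list l) = 1 / real g * (\<Sum>i=1..t. (r i)\<^sup>2)
     - (real g + 2) * (real_of_int \<lfloor>real g / 2\<rfloor> + 1) / 12" .
  have "(\<Prod>s\<in>boxes l. \<tau> (hook_length l s - diag_sign s * int g) / \<tau> (hook_length l s)) =
           (\<Prod>i=1..g - 1. (\<tau> (- int i) / \<tau> (int i)) ^ hook_count g l i) *
           (\<Prod>(i, j)\<in>{(i, j). 1 \<le> i \<and> i < j \<and> j \<le> t}.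
              \<tau> \<lfloor>r i - r j\<rfloor> / \<tau> (int j - int i) *
              (\<tau> \<lfloor>r i + r j\<rfloor> / \<tau> (int g + 2 - int i - int j)))"
    if nz: "\<And>k. \<tau> k \<noteq> 0" for \<tau> :: "int \<Rightarrow> 'a"
  proof -
    define \<sigma> where "\<sigma> k = \<tau> \<bar>k\<bar>" for k
    interpret even_weight \<sigma> "int g"
      using nz g(1) by unfold_locales (auto simp: \<sigma>_def)
    \<comment> \<open>A decreasing enumeration of \<open>{t..g}\<close>, chosen so that
      \<open>u i - u j = j - i\<close> and \<open>u i + u j - g = g + 2 - i - j\<close>.\<close>
    define u where "u i = int g + 1 - int i" for i
    have "u ` {1..t} = {int t..int g}"
    proof (intro equalityI subsetI)
      fix x assume "x \<in> {int t..int g}"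
      then show "x \<in> u ` {1..t}" using g
        by (intro image_eqI[of _ _ "nat (int g + 1 - x)"]) (auto simp: u_def)
    qed (use g in \<open>auto simp: u_def\<close>)
    then have "pair_prod N C = pair_prod (\<lambda>i j. N (u i) (u j)) {1..t}"
      unfolding pair_prod_half_system[OF hs g(2,3)]
      using pair_prod_reindex[of "{1..t}" u N] N_commute by (simp add: u_def inj_on_def)
    moreover have "pair_prod (\<lambda>c d. N (b c) (b d)) C = pair_prod (\<lambda>i j. N (w i) (w j)) {1..t}"
      using pair_prod_reindex[OF _ injw, of N] pair_prod_reindex[OF fin injb, of N] N_commute w_image
      by simp
    moreover have "pair_prod N C \<noteq> 0" using fin by (intro pair_prod_nonzero) auto
    ultimately have "bead_prod (pos_beads l) =
        pair_prod (\<lambda>i j. N (w i) (w j)) {1..t} / pair_prod (\<lambda>i j. N (u i) (u j)) {1..t}"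
      using bead_prod_chains[OF hs, of n] unfolding beads b_def by (simp add: field_simps)
    also have "\<dots> = (\<Prod>(i, j)\<in>{(i, j). 1 \<le> i \<and> i < j \<and> j \<le> t}. N (w i) (w j) / N (u i) (u j))"
    proof -
      have "{(i, j). i \<in> {1..t} \<and> j \<in> {1..t} \<and> i < j} = {(i, j). 1 \<le> i \<and> i < j \<and> j \<le> t}"
        by auto
      then show ?thesis by (simp add: pair_prod_def prod_dividef[symmetric] case_prod_unfold)
    qed
    also have "\<dots> = (\<Prod>(i, j)\<in>{(i, j). 1 \<le> i \<and> i < j \<and> j \<le> t}.
              \<tau> \<lfloor>r i - r j\<rfloor> / \<tau> (int j - int i) *
              (\<tau> \<lfloor>r i + r j\<rfloor> / \<tau> (int g + 2 - int i - int j)))"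
    proof (intro prod.cong refl, clarify)
      fix i j assume ij: "1 \<le> i" "i < j" "j \<le> t"
      have "r i - r j = real_of_int (w i - w j)" "r i + r j = real_of_int (w i + w j - int g)"
        using r[of i] r[of j] ij by auto
      then have fl: "\<lfloor>r i - r j\<rfloor> = w i - w j" "\<lfloor>r i + r j\<rfloor> = w i + w j - int g"
        by (metis floor_of_int)+
      have "N (w i) (w j) = \<tau> (w i - w j) * \<tau> (w i + w j - int g)"
        using w_less[OF ij] w_big[of i] w_big[of j] ij by (simp add: pm_prod_def \<sigma>_def)
      moreover have "N (u i) (u j) = \<tau> (int j - int i) * \<tau> (int g + 2 - int i - int j)"
      proof -
        have "u i - u j = int j - int i" "u i + u j - int g = int g + 2 - int i - int j"
          by (simp_all add: u_def)
        moreover have "int j - int i \<ge> 0" "int g + 2 - int i - int j \<ge> 0" using ij g(2) by linarith+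
        ultimately show ?thesis by (simp only: pm_prod_def \<sigma>_def abs_of_nonneg)
      qed
      ultimately show "N (w i) (w j) / N (u i) (u j) = \<tau> \<lfloor>r i - r j\<rfloor> / \<tau> (int j - int i) *
              (\<tau> \<lfloor>r i + r j\<rfloor> / \<tau> (int g + 2 - int i - int j))"
        unfolding fl by simp
    qed
    finally have *: "bead_prod (pos_beads l) = (\<Prod>(i, j)\<in>{(i, j). 1 \<le> i \<and> i < j \<and> j \<le> t}.
              \<tau> \<lfloor>r i - r j\<rfloor> / \<tau> (int j - int i) *
              (\<tau> \<lfloor>r i + r j\<rfloor> / \<tau> (int g + 2 - int i - int j)))" .
    have "\<sigma> = (\<lambda>k. \<tau> \<bar>k\<bar>)" by (rule ext) (rule \<sigma>_def)
    note hook_prod_eq_bead_prod[OF l, of \<tau> g, OF nz g(1), folded this]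
    then show ?thesis unfolding * .
  qed
  with size show ?thesis by blast
qed

end
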